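(* Let $\pi$ be an irreducible permutation on a finite alphabet $\mathcal{A}$, and let $2g=\dim H(\pi)$. Then the action of the Rauzy monoid $\Pi(\pi)$ on $H(\pi)$ is strongly pinching: for every $C>0$ there is $\gamma\in\Pi(\pi)$ such that, writing $x=\Theta(\gamma)|_{H(\pi)}$, $\ln\sigma_g(x)>C$ and $\ln\sigma_i(x)>C\ln\sigma_{i+1}(x)$ for all $1\le i\le g-1$.
   Context: $\sigma_1(x)\ge\dots\ge\sigma_{2g}(x)$ denote the singular values of $x$ with respect to an inner product on $H(\pi)$ (the property does not depend on the choice). A permutation is a pair $\pi=(\pi_0,\pi_1)$ of bijections $\mathcal{A}\to\{1,\dots,d\}$, $d\ge2$; irreducible means no $1\le k<d$ with $\pi_0^{-1}(\{1,\dots,k\})=\pi_1^{-1}(\{1,\dots,k\})$. $\Omega(\pi)$ on $\mathbb{R}^{\mathcal{A}}$: $\langle\Omega(\pi)e_x,e_y\rangle=1$ if $\pi_0(x)>\pi_0(y),\pi_1(x)<\pi_1(y)$; $-1$ if $\pi_0(x)<\pi_0(y),\pi_1(x)>\pi_1(y)$; $0$ otherwise; $H(\pi)=\Omega(\pi)\mathbb{R}^{\mathcal{A}}$. Rauzy operations: with $x,y$ the last letters of top and bottom rows, the top operation moves $y$ in the bottom row to just right of $x$ (winner $x$, loser $y$), the bottom operation moves $x$ in the top row to just right of $y$ (winner $y$, loser $x$). $\Pi(\pi)$ is the monoid of paths in the Rauzy diagram starting and ending at $\pi$. For an arrow with winner $w$, loser $\ell$: $\Theta(\gamma)e_w=e_w+e_\ell$,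 $\Theta(\gamma)e_z=e_z$ otherwise; $\Theta(\gamma_1\gamma_2)=\Theta(\gamma_2)\Theta(\gamma_1)$; $\Theta(\gamma)$ preserves $H(\pi)$ for $\gamma\in\Pi(\pi)$. *)

theory Defs
  imports "HOL-Analysis.Analysis"
begin

type_synonym 'a perm_pair = "('a \<Rightarrow> nat) \<times> ('a \<Rightarrow> nat)"

definition is_perm :: "('a::finite) perm_pair \<Rightarrow> bool" where
  "is_perm p \<longleftrightarrow> bij_betw (fst p) UNIV {1..CARD('a)} \<and> bij_betw (snd p) UNIV {1..CARD('a)}"

definition irreducible_perm :: "('a::finite) perm_pair \<Rightarrow> bool" where
  "irreducible_perm p \<longleftrightarrow>
     \<not> (\<exists>k. 1 \<le> k \<and> k < CARD('a) \<and> fst p -` {1..k} = snd p -` {1..k})"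

text \<open>The matrix Omega(pi): entry in row y, column x is the pairing of Omega e_x with e_y.\<close>
definition Omega :: "('a::finite) perm_pair \<Rightarrow> real^'a^'a" where
  "Omega p = (\<chi> y x.
     if fst p x > fst p y \<and> snd p x < snd p y then 1
     else if fst p x < fst p y \<and> snd p x > snd p y then -1 else 0)"

definition Hsp :: "('a::finite) perm_pair \<Rightarrow> (real^'a) set" where
  "Hsp p = range (\<lambda>v. Omega p *v v)"

definition last_top :: "('a::finite) perm_pair \<Rightarrow> 'a" where
  "last_top p = (THE z. fst p z = CARD('a))"

definition last_bot :: "('a::finite) perm_pair \<Rightarrow> 'a" where
  "last_bot p = (THE z. snd p z = CARD('a))"

text \<open>Top operation: move y (last of bottom row) in the bottom row to just right of x.\<close>
definition top_op :: "('a::finite) perm_pair \<Rightarrow> 'a perm_pair" where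
  "top_op p = (let x = last_top p; y = last_bot p in
     (fst p, \<lambda>z. if z = y then snd p x + 1
                else if snd p z > snd p x then snd p z + 1 else snd p z))"

text \<open>Bottom operation: move x (last of top row) in the top row to just right of y.\<close>
definition bot_op :: "('a::finite) perm_pair \<Rightarrow> 'a perm_pair" where
  "bot_op p = (let x = last_top p; y = last_bot p in
     (\<lambda>z. if z = x then fst p y + 1
          else if fst p z > fst p y then fst p z + 1 else fst p z, snd p))"

definition rauzy_step :: "('a::finite) perm_pair \<Rightarrow> bool \<Rightarrow> 'a perm_pair" where
  "rauzy_step p b = (if b then top_op p else bot_op p)"

definition winner :: "('a::finite) perm_pair \<Rightarrow> bool \<Rightarrow> 'a" where
  "winner p b = (if b then last_top p else last_bot p)"

definition loser :: "('a::finite) perm_pair \<Rightarrow> bool \<Rightarrow> 'a" where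
  "loser p b = (if b then last_bot p else last_top p)"

definition path_end :: "('a::finite) perm_pair \<Rightarrow> bool list \<Rightarrow> 'a perm_pair" where
  "path_end p bs = foldl rauzy_step p bs"

definition theta_arrow :: "('a::finite) perm_pair \<Rightarrow> bool \<Rightarrow> real^'a^'a" where
  "theta_arrow p b = (\<chi> i j. if i = j then 1
                       else if i = loser p b \<and> j = winner p b then 1 else 0)"

text \<open>Theta of a path, with Theta(gamma1 gamma2) = Theta(gamma2) Theta(gamma1).\<close>
fun theta :: "('a::finite) perm_pair \<Rightarrow> bool list \<Rightarrow> real^'a^'a" where
  "theta p [] = mat 1"
| "theta p (b # bs) = theta (rauzy_step p b) bs ** theta_arrow p b"

definition rauzy_monoid :: "('a::finite) perm_pair \<Rightarrow> bool list set" where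
  "rauzy_monoid p = {bs. path_end p bs = p}"

text \<open>i-th singular value (i \<ge> 1, decreasing order) of a linear map f on the subspace H,
  w.r.t. the standard inner product restricted to H, via the min-max characterisation.\<close>
definition sval :: "(real^('n::finite)) set \<Rightarrow> (real^'n \<Rightarrow> real^'n) \<Rightarrow> nat \<Rightarrow> real" where
  "sval H f i = Sup {Inf {norm (f v) | v. v \<in> V \<and> norm v = 1} | V. subspace V \<and> V \<subseteq> H \<and> dim V = i}"

end

theory Submission
  imports Defs
begin

text \<open>At any permutation, iterating the top operation until it returns gives a loop whose matrix is the
  transvection \<open>I + \<Omega> e e\<^sup>T\<close>, \<open>e\<close> the basis vector of the last top letter. Inserting powers \<open>n\<^sub>j\<close> of such
  loops along a closed path with matrix \<open>K\<close> gives \<open>K \<cdot> \<Prod>\<^sub>j (I + n\<^sub>j \<Omega> q\<^sub>j q\<^sub>j\<^sup>T)\<close>, where \<open>q\<^sub>j\<close> is \<open>e\<close> pulled back to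
  the initial permutation. If the \<open>q\<^sub>j\<close> are pairwise \<open>\<Omega>\<close>-orthogonal and their images under \<open>\<Omega>\<close> are
  independent, this is \<open>K (I + \<Sum>\<^sub>j n\<^sub>j \<Omega> q\<^sub>j q\<^sub>j\<^sup>T)\<close>, with singular values comparable to \<open>n\<^sub>1, \<dots>, n\<^sub>g\<close>, which are at
  our disposal. So it suffices to find a path whose \<open>q\<^sub>j\<close> span a Lagrangian. This is by induction on the
  number of letters: move to a standard permutation \<open>A \<tau> Z / Z \<tau>' A\<close>, rotate \<open>Z\<close> next to \<open>A\<close> in the
  top row, collect a Lagrangian for each irreducible block of \<open>(\<tau>, \<tau>')\<close> while rotating the top row with
  winner \<open>A\<close>, and finally use the loop at \<open>Z\<close>, which is orthogonal to all letters except \<open>A\<close>.\<close>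

subsection \<open>Rows of a permutation and cyclic rotation\<close>

lemma bool_neq_cases: "P b \<Longrightarrow> P (\<not> b) \<Longrightarrow> P c"
  by (cases b; cases c) simp_all

text \<open>Indexing rows by the type of operation treats both types at once: operation
  \<open>b\<close> keeps \<open>row p b\<close>, in which its winner is last, and permutes
  \<open>row p (\<not> b)\<close>, in which its loser is last.\<close>

definition row :: "('a::finite) perm_pair \<Rightarrow> bool \<Rightarrow> 'a \<Rightarrow> nat" where
  "row p c = (if c then fst p else snd p)"

lemma is_perm_row:
  "is_perm (p :: ('a::finite) perm_pair) \<longleftrightarrow> (\<forall>c. bij_betw (row p c) UNIV {1..CARD('a)})"
  by (auto simp: is_perm_def row_def split: if_splits)

lemma is_permI:
  fixes p :: "('a::finite) perm_pair"
  assumes "bij_betw (row p (\<not> b)) UNIV {1..CARD('a)}" "bij_betw (row p b) UNIV {1..CARD('a)}"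
  shows "is_perm p"
  using assms unfolding is_perm_row by (cases b) (auto elim: bool_neq_cases)

lemma row_eq_iff: "is_perm p \<Longrightarrow> row p c x = row p c y \<longleftrightarrow> x = y"
  by (auto simp: is_perm_row bij_betw_def inj_eq)

lemma row_bounds:
  fixes p :: "('a::finite) perm_pair"
  assumes "is_perm p"
  shows "1 \<le> row p c x" "row p c x \<le> CARD('a)"
proof -
  have "row p c x \<in> {1..CARD('a)}"
    using assms by (meson UNIV_I bij_betwE is_perm_row)
  then show "1 \<le> row p c x" "row p c x \<le> CARD('a)" by auto
qed

lemma the_row_last:
  fixes p :: "('a::finite) perm_pair"
  assumes "is_perm p"
  shows "row p c (THE z. row p c z = CARD('a)) = CARD('a)"
proof -
  have "CARD('a) \<in> row p c ` UNIV"
    using assms by (auto simp: is_perm_row bij_betw_def Suc_le_eq)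
  then obtain z where z: "row p c z = CARD('a)" by (elim imageE) (rule that, rule sym)
  then show ?thesis
    by (rule theI) (use z row_eq_iff[OF assms, of c _ z] in simp)
qed

lemma row_winner:
  fixes p :: "('a::finite) perm_pair"
  assumes "is_perm p"
  shows "row p b (winner p b) = CARD('a)"
  using the_row_last[OF assms, of b]
  by (simp add: winner_def last_top_def last_bot_def row_def split: if_splits)

lemma loser_eq_winner: "loser p b = winner p (\<not> b)"
  by (simp add: winner_def loser_def)

lemma row_loser:
  fixes p :: "('a::finite) perm_pair"
  assumes "is_perm p"
  shows "row p (\<not> b) (loser p b) = CARD('a)"
  using row_winner[OF assms] by (simp add: loser_eq_winner)

lemma winner_eqI:
  fixes p :: "('a::finite) perm_pair"
  assumes "is_perm p" "row p b x = CARD('a)"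
  shows "winner p b = x"
  using assms(2) row_winner[OF assms(1), of b] row_eq_iff[OF assms(1), of b x "winner p b"] by simp

lemma row_less_card:
  fixes p :: "('a::finite) perm_pair"
  assumes "is_perm p" "x \<noteq> winner p b"
  shows "row p b x < CARD('a)"
proof -
  have "row p b x \<noteq> CARD('a)"
    using winner_eqI[OF assms(1), of b x] assms(2) by blast
  then show ?thesis
    using row_bounds(2)[OF assms(1), of b x] by (rule le_neq_implies_less[rotated])
qed

text \<open>With \<open>a\<close> the position of the winner in the other row, this is the effect
  there of \<open>k\<close> successive operations of one type. A single wrap suffices as long as
  \<open>a + k \<le> d\<close>.\<close>

definition rot :: "nat \<Rightarrow> nat \<Rightarrow> nat \<Rightarrow> nat \<Rightarrow> nat" where
  "rot d a k m = (if m \<le> a then m else if m + k \<le> d then m + k else m + k - (d - a))"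

lemma rot_bij:
  assumes "a + k \<le> d"
  shows "bij_betw (rot d a k) {1..d} {1..d}"
proof -
  have "inj_on (rot d a k) {1..d}"
    using assms by (auto simp: inj_on_def rot_def split: if_splits)
  moreover have "rot d a k ` {1..d} \<subseteq> {1..d}"
    using assms by (auto simp: rot_def split: if_splits)
  ultimately show ?thesis
    by (simp add: bij_betw_def endo_inj_surj)
qed

lemma row_step_same: "row (rauzy_step p b) b = row p b"
  by (simp add: rauzy_step_def top_op_def bot_op_def row_def Let_def)

lemma row_step_other:
  fixes p :: "('a::finite) perm_pair"
  assumes "is_perm p" "winner p b \<noteq> loser p b"
  shows "row (rauzy_step p b) (\<not> b) z = rot CARD('a) (row p (\<not> b) (winner p b)) 1 (row p (\<not> b) z)"
proof -
  let ?r = "row p (\<not> b)"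
  have 1: "row (rauzy_step p b) (\<not> b) z =
    (if z = loser p b then ?r (winner p b) + 1 else if ?r z > ?r (winner p b) then ?r z + 1 else ?r z)"
    by (simp add: rauzy_step_def top_op_def bot_op_def row_def Let_def winner_def loser_def)
  have l: "?r (loser p b) = CARD('a)" using row_loser[OF assms(1)] .
  have w: "?r (winner p b) < CARD('a)"
    using assms row_less_card[of p "winner p b" "\<not> b"] by (simp add: loser_eq_winner)
  show ?thesis
  proof (cases "z = loser p b")
    case True
    then show ?thesis using 1 l w by (simp add: rot_def)
  next
    case False
    then have "?r z < CARD('a)"
      using assms row_less_card[of p z "\<not> b"] by (simp add: loser_eq_winner)
    then show ?thesis using 1 False w by (simp add: rot_def)
  qed
qed

lemma winner_row_less:
  fixes p :: "('a::finite) perm_pair"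
  assumes "is_perm p"
  shows "winner p b \<noteq> loser p b \<longleftrightarrow> row p (\<not> b) (winner p b) < CARD('a)"
  using row_loser[OF assms, of b] row_less_card[OF assms, of "winner p b" "\<not> b"]
  by (auto simp: loser_eq_winner)

lemma is_perm_step:
  fixes p :: "('a::finite) perm_pair"
  assumes "is_perm p" "winner p b \<noteq> loser p b"
  shows "is_perm (rauzy_step p b)"
proof -
  let ?a = "row p (\<not> b) (winner p b)"
  have "bij_betw (rot CARD('a) ?a 1 \<circ> row p (\<not> b)) UNIV {1..CARD('a)}"
    using assms winner_row_less[OF assms(1)] is_perm_row[of p]
    by (intro bij_betw_trans[OF _ rot_bij]) auto
  moreover have "rot CARD('a) ?a 1 \<circ> row p (\<not> b) = row (rauzy_step p b) (\<not> b)"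
    using row_step_other[OF assms] by auto
  ultimately have "bij_betw (row (rauzy_step p b) (\<not> b)) UNIV {1..CARD('a)}" by simp
  moreover have "bij_betw (row (rauzy_step p b) b) UNIV {1..CARD('a)}"
    using assms by (simp add: is_perm_row row_step_same)
  ultimately show ?thesis by (rule is_permI)
qed

lemma winner_step:
  assumes "is_perm p" "winner p b \<noteq> loser p b"
  shows "winner (rauzy_step p b) b = winner p b"
  by (rule winner_eqI[OF is_perm_step[OF assms]]) (simp add: row_step_same row_winner[OF assms(1)])

lemma rot_Suc:
  assumes "a + Suc k \<le> d" "1 \<le> m" "m \<le> d"
  shows "rot d a 1 (rot d a k m) = rot d a (Suc k) m"
  using assms by (auto simp: rot_def)

abbreviation cyc :: "('a::finite) perm_pair \<Rightarrow> bool \<Rightarrow> nat \<Rightarrow> 'a perm_pair" where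
  "cyc p b k \<equiv> ((\<lambda>q. rauzy_step q b) ^^ k) p"

lemma cyc:
  fixes p :: "('a::finite) perm_pair"
  assumes "is_perm p" "row p (\<not> b) (winner p b) + k \<le> CARD('a)"
  shows "is_perm (cyc p b k)" "row (cyc p b k) b = row p b" "winner (cyc p b k) b = winner p b"
    "row (cyc p b k) (\<not> b) z = rot CARD('a) (row p (\<not> b) (winner p b)) k (row p (\<not> b) z)"
proof -
  let ?a = "row p (\<not> b) (winner p b)"
  have "is_perm (cyc p b k) \<and> row (cyc p b k) b = row p b \<and> winner (cyc p b k) b = winner p b \<and>
    (\<forall>z. row (cyc p b k) (\<not> b) z = rot CARD('a) ?a k (row p (\<not> b) z))"
    using assms(2)
  proof (induction k)
    case 0
    then show ?case using assms row_bounds[OF assms(1)] by (auto simp: rot_def)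
  next
    case (Suc k)
    let ?p = "cyc p b k"
    have IH: "is_perm ?p" "row ?p b = row p b" "winner ?p b = winner p b"
      "\<And>z. row ?p (\<not> b) z = rot CARD('a) ?a k (row p (\<not> b) z)" using Suc by auto
    have a: "row ?p (\<not> b) (winner ?p b) = ?a" using IH by (simp add: rot_def)
    then have wl: "winner ?p b \<noteq> loser ?p b"
      using Suc.prems winner_row_less[OF IH(1)] by auto
    have S: "cyc p b (Suc k) = rauzy_step ?p b" by simp
    have "row (rauzy_step ?p b) (\<not> b) z = rot CARD('a) ?a (Suc k) (row p (\<not> b) z)" for z
      unfolding row_step_other[OF IH(1) wl] unfolding a unfolding IH(4)
      by (rule rot_Suc[OF Suc.prems row_bounds[OF assms(1)]])
    then show ?case
      unfolding S row_step_same winner_step[OF IH(1) wl] IH(2,3)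
      using is_perm_step[OF IH(1) wl] by blast
  qed
  then show "is_perm (cyc p b k)" "row (cyc p b k) b = row p b" "winner (cyc p b k) b = winner p b"
    "row (cyc p b k) (\<not> b) z = rot CARD('a) ?a k (row p (\<not> b) z)" by auto
qed

lemma perm_eqI: "row p b = row q b \<Longrightarrow> row p (\<not> b) = row q (\<not> b) \<Longrightarrow> p = q"
  by (cases b) (simp_all add: row_def prod_eq_iff)

text \<open>The positions beyond the winner are shifted cyclically by their own number.\<close>

lemma cyc_period:
  fixes p :: "('a::finite) perm_pair"
  assumes "is_perm p"
  shows "cyc p b (CARD('a) - row p (\<not> b) (winner p b)) = p"
proof -
  let ?a = "row p (\<not> b) (winner p b)"
  have "?a + (CARD('a) - ?a) \<le> CARD('a)" using row_bounds[OF assms] by simp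
  note * = cyc[OF assms this]
  have "rot CARD('a) ?a (CARD('a) - ?a) (row p (\<not> b) z) = row p (\<not> b) z" for z
    using row_bounds[OF assms, of "\<not> b"] by (auto simp: rot_def)
  then have "row (cyc p b (CARD('a) - ?a)) (\<not> b) = row p (\<not> b)"
    using *(4) by (intro ext) simp
  with *(2) show ?thesis by (rule perm_eqI)
qed

subsection \<open>Matrices of Rauzy steps\<close>

lemma theta_arrow_mult:
  "theta_arrow p b *v v = v + axis (loser p b) (v $ winner p b)" if "winner p b \<noteq> loser p b"
proof -
  have "(\<Sum>j\<in>UNIV. (if i = j then 1 else if i = loser p b \<and> j = winner p b then 1 else 0) * v $ j)
     = v $ i + (if i = loser p b then v $ winner p b else 0)" for i
  proof -
    have "(\<Sum>j\<in>UNIV. (if i = j then 1 else if i = loser p b \<and> j = winner p b then 1 else 0) * v $ j)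
     = (\<Sum>j\<in>UNIV. (if j = i then v $ j else 0) + (if j = winner p b then (if i = loser p b then v $ j else 0) else 0))"
      using that by (intro sum.cong) auto
    also have "\<dots> = v $ i + (if i = loser p b then v $ winner p b else 0)"
      by (simp add: sum.distrib)
    finally show ?thesis .
  qed
  then show ?thesis
    by (auto simp: vec_eq_iff theta_arrow_def matrix_vector_mult_def axis_def)
qed

lemma theta_arrow_vmult:
  "v v* theta_arrow p b = v + axis (winner p b) (v $ loser p b)" if "winner p b \<noteq> loser p b"
proof (rule vec_eq_iff[THEN iffD2], rule allI)
  fix i
  have "(v v* theta_arrow p b) $ i = v \<bullet> (theta_arrow p b *v axis i 1)"
    by (simp add: dot_lmul_matrix[symmetric] inner_axis)
  then show "(v v* theta_arrow p b) $ i = (v + axis (winner p b) (v $ loser p b)) $ i"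
    unfolding theta_arrow_mult[OF that]
    by (simp add: inner_add_right inner_axis) (simp add: axis_def)
qed

lemma Omega_nth:
  "Omega p $ y $ x = (if row p True x > row p True y \<and> row p False x < row p False y then 1
     else if row p True x < row p True y \<and> row p False x > row p False y then -1 else 0)"
  by (simp add: Omega_def row_def)

lemma Omega_antisym: "Omega p $ y $ x = - Omega p $ x $ y"
  by (auto simp: Omega_nth)

lemma transpose_Omega: "transpose (Omega p) = - Omega p"
  unfolding vec_eq_iff transpose_def by (auto intro: Omega_antisym)

text \<open>The congruence of \<open>Omega p\<close> by \<open>theta_arrow p b\<close>, written out;
  its quadratic term drops out because the diagonal of \<open>Omega p\<close> is zero. Off the
  loser's row and column the relative orders do not change.\<close>

lemma Omega_step_nth:
  fixes p :: "('a::finite) perm_pair"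
  assumes p: "is_perm p" and wl: "winner p b \<noteq> loser p b"
  defines "w \<equiv> winner p b" and "l \<equiv> loser p b"
  shows "Omega (rauzy_step p b) $ i $ j = Omega p $ i $ j + (if i = l then Omega p $ w $ j else 0)
     + (if j = l then Omega p $ i $ w else 0)"
proof -
  let ?p = "rauzy_step p b"
  have w: "row p b w = CARD('a)" and l: "row p (\<not> b) l = CARD('a)"
    using row_winner[OF p] row_loser[OF p] by (auto simp: w_def l_def)
  have lw: "row p b z < CARD('a)" if "z \<noteq> w" for z
    using row_less_card[OF p, of z b] that by (simp add: w_def)
  have ll: "row p (\<not> b) z < CARD('a)" if "z \<noteq> l" for z
    using row_less_card[OF p, of z "\<not> b"] that by (simp add: l_def loser_eq_winner)
  have s: "row ?p b = row p b" by (rule row_step_same)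
  have o: "row ?p (\<not> b) z = (if z = l then row p (\<not> b) w + 1
      else if row p (\<not> b) z \<le> row p (\<not> b) w then row p (\<not> b) z else row p (\<not> b) z + 1)" for z
    using row_step_other[OF p wl, of z] l ll[of z] ll[of w] wl
    by (auto simp: rot_def w_def l_def)
  have ne: "row p c x \<noteq> row p c y" if "x \<noteq> y" for c x y using row_eq_iff[OF p] that by blast
  have lw': "l \<noteq> w" using wl by (auto simp: w_def l_def)
  have 1: "Omega ?p $ i $ j = Omega p $ i $ j" if "i \<noteq> l" "j \<noteq> l" for i j
  proof -
    have "row ?p c i < row ?p c j \<longleftrightarrow> row p c i < row p c j"
      if "i \<noteq> l" "j \<noteq> l" for c i j
      using that s o[of i] o[of j] by (cases "c = b") auto
    then show ?thesis using that by (simp add: Omega_nth)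
  qed
  have 2: "Omega ?p $ l $ j = Omega p $ l $ j + Omega p $ w $ j" if "j \<noteq> l" for j
  proof (cases "j = w")
    case True
    then show ?thesis
      using lw' s o[of l] o[of w] w l lw[of l] ll[of w] by (cases b) (simp_all add: Omega_nth)
  next
    case False
    then show ?thesis
      using lw' that s o[of l] o[of j] w l lw[of l] ll[of w] lw[of j] ll[of j] ne[of j l b] ne[of j w "\<not> b"]
      by (cases b) (auto simp: Omega_nth)
  qed
  have 3: "Omega q $ k $ k = 0" for q :: "'a perm_pair" and k by (simp add: Omega_nth)
  show ?thesis
    using 1[of i j] 2[of i] 2[of j] 3 Omega_antisym[of ?p i j] Omega_antisym[of p i j]
      Omega_antisym[of p i w] Omega_antisym[of p l w] by auto
qed

text \<open>Since \<open>q v* K\<close> is the transpose of \<open>K\<close> applied to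
  \<open>q\<close>, the new form is the old one pulled back by the transposed matrix.\<close>

lemma Omega_step:
  fixes p :: "('a::finite) perm_pair"
  assumes "is_perm p" "winner p b \<noteq> loser p b"
  shows "Omega (rauzy_step p b) *v q = theta_arrow p b *v (Omega p *v (q v* theta_arrow p b))"
proof (rule vec_eq_iff[THEN iffD2], rule allI)
  fix i
  let ?w = "winner p b" and ?l = "loser p b"
  have ax: "(\<Sum>j\<in>UNIV. (if j = ?l then c else 0) * q $ j) = c * q $ ?l" for c
    by (subst sum.cong[of UNIV UNIV _ "\<lambda>j. if j = ?l then c * q $ j else 0"]) auto
  have "(Omega (rauzy_step p b) *v q) $ i =
    (Omega p *v q) $ i + (if i = ?l then (Omega p *v q) $ ?w else 0) + Omega p $ i $ ?w * q $ ?l"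
    unfolding matrix_vector_mult_def
    by (simp add: Omega_step_nth[OF assms] distrib_right sum.distrib ax)
  moreover have "(Omega p *v axis ?w c) $ k = Omega p $ k $ ?w * c" for k c
    by (simp add: matrix_vector_mult_def axis_def if_distrib cong: if_cong)
  moreover have "Omega p $ ?w $ ?w = 0" by (simp add: Omega_nth)
  ultimately show "(Omega (rauzy_step p b) *v q) $ i =
    (theta_arrow p b *v (Omega p *v (q v* theta_arrow p b))) $ i"
    unfolding theta_arrow_mult[OF assms(2)] theta_arrow_vmult[OF assms(2)]
    by (simp add: matrix_vector_right_distrib axis_def)
qed

subsection \<open>Sweeps\<close>

text \<open>\<open>sweep B p Q p' K\<close>: there is a path from \<open>p\<close> to \<open>p'\<close> with matrix \<open>K\<close> all of whose winners lie in \<open>B\<close>,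
  and \<open>Q\<close> collects the transvection vectors, pulled back to \<open>p\<close>, of the top loops available on the way.
  The letters outside \<open>B\<close> are passive, so one type of letters serves for the induction on \<open>card B\<close>.\<close>
inductive sweep :: "('a::finite) set \<Rightarrow> 'a perm_pair \<Rightarrow> (real^'a) set \<Rightarrow> 'a perm_pair \<Rightarrow> real^'a^'a \<Rightarrow> bool"
  for B where
  sweep_refl: "sweep B p {} p (mat 1)"
| sweep_step: "winner p b \<in> B \<Longrightarrow> winner p b \<noteq> loser p b \<Longrightarrow>
    sweep B p {} (rauzy_step p b) (theta_arrow p b)"
| sweep_loop: "winner p True \<in> B \<Longrightarrow> sweep B p {axis (winner p True) 1} p (mat 1)"
| sweep_trans: "sweep B p Q p' K \<Longrightarrow> sweep B p' Q' p'' K' \<Longrightarrow>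
    sweep B p (Q \<union> (\<lambda>q. q v* K) ` Q') p'' (K' ** K)"

lemma sweep_mono:
  assumes "sweep B p Q p' K" "B \<subseteq> C"
  shows "sweep C p Q p' K"
  using assms
  by (induction rule: sweep.induct) (blast intro: sweep.intros)+

section \<open>Transposed sweep matrices on vectors supported in \<open>B\<close>\<close>

definition supp :: "('a::finite) set \<Rightarrow> (real^'a) set" where
  "supp B = {v. \<forall>z. z \<notin> B \<longrightarrow> v $ z = 0}"

lemma sweep_is_perm:
  assumes "sweep B p Q p' K" "is_perm p"
  shows "is_perm p'"
  using assms by (induction rule: sweep.induct) (auto intro: is_perm_step)

lemma sweep_finite:
  assumes "sweep B p Q p' K"
  shows "finite Q"
  using assms by (induction rule: sweep.induct) auto

lemma sweep_Omega:
  assumes "sweep B p Q p' K" "is_perm p"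
  shows "Omega p' *v q = K *v (Omega p *v (q v* K))"
  using assms
proof (induction arbitrary: q rule: sweep.induct)
  case (sweep_trans p Q p' K Q' p'' K')
  have "is_perm p'" using sweep_is_perm sweep_trans by blast
  then show ?case
    using sweep_trans by (simp add: matrix_vector_mul_assoc vector_matrix_mul_assoc matrix_mul_assoc)
qed (auto simp: Omega_step)

lemma vector_matrix_mult_diff: "v v* (A - B) = v v* A - v v* (B :: real^'n^'m)"
  by (simp add: vec_eq_iff vector_matrix_mult_def right_diff_distrib sum_subtractf)

text \<open>For distinct winner and loser, \<open>theta_arrow p b - mat 1\<close> is one
  off-diagonal entry, hence of square zero, and changing its sign inverts the matrix.\<close>

definition theta_arrow_inv :: "('a::finite) perm_pair \<Rightarrow> bool \<Rightarrow> real^'a^'a" where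
  "theta_arrow_inv p b = mat 1 - (theta_arrow p b - mat 1)"

lemma theta_arrow_inv:
  assumes "winner p b \<noteq> loser p b"
  shows "theta_arrow_inv p b ** theta_arrow p b = mat 1"
    "theta_arrow p b ** theta_arrow_inv p b = mat 1"
    "v v* theta_arrow_inv p b = v - axis (winner p b) (v $ loser p b)"
proof -
  have J: "theta_arrow_inv p b *v v = v - axis (loser p b) (v $ winner p b)" for v
    unfolding theta_arrow_inv_def matrix_vector_mult_diff_rdistrib theta_arrow_mult[OF assms] matrix_vector_mul_lid
    by (simp only: add_diff_cancel_left')
  show "theta_arrow_inv p b ** theta_arrow p b = mat 1" "theta_arrow p b ** theta_arrow_inv p b = mat 1"
    using assms unfolding matrix_eq matrix_vector_mul_assoc[symmetric] J theta_arrow_mult[OF assms]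
    by (simp_all add: axis_def vec_eq_iff)
  show "v v* theta_arrow_inv p b = v - axis (winner p b) (v $ loser p b)"
    unfolding theta_arrow_inv_def vector_matrix_mult_diff theta_arrow_vmult[OF assms] vector_matrix_mul_rid
    by (simp only: add_diff_cancel_left')
qed

text \<open>A transposed step adds a multiple to the winner's coordinate only. Winners lie in
  \<open>B\<close>, so neither these maps nor their inverses leave \<open>supp B\<close>, even when
  a loser is outside \<open>B\<close>.\<close>

lemma sweep_inverse:
  assumes "sweep B p Q p' K"
  shows "(\<forall>v\<in>supp B. v v* K \<in> supp B) \<and>
    (\<exists>J. J ** K = mat 1 \<and> K ** J = mat 1 \<and> (\<forall>v\<in>supp B. v v* J \<in> supp B))"
  using assms
proof (induction rule: sweep.induct)
  case (sweep_refl p)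
  then show ?case by (auto intro!: exI[of _ "mat 1"])
next
  case (sweep_step p b)
  then show ?case
    using theta_arrow_inv[of p b]
    by (intro conjI exI[of _ "theta_arrow_inv p b"])
      (auto simp: theta_arrow_vmult supp_def axis_def)
next
  case (sweep_loop p)
  then show ?case by (auto intro!: exI[of _ "mat 1"])
next
  case (sweep_trans p Q p' K Q' p'' K')
  then obtain J J' where J: "J ** K = mat 1" "K ** J = mat 1" "\<forall>v\<in>supp B. v v* J \<in> supp B"
    and J': "J' ** K' = mat 1" "K' ** J' = mat 1" "\<forall>v\<in>supp B. v v* J' \<in> supp B" by blast
  have "(J ** J') ** (K' ** K) = J ** (J' ** K') ** K" "(K' ** K) ** (J ** J') = K' ** (K ** J) ** J'"
    by (simp_all only: matrix_mul_assoc)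
  then show ?case
    using J J' sweep_trans.IH
    by (intro conjI exI[of _ "J ** J'"]) (auto simp: vector_matrix_mul_assoc[symmetric])
qed

section \<open>Order relations preserved along sweeps\<close>

lemma rot_less:
  assumes "a < d" "m \<le> a" "m < m'"
  shows "rot d a 1 m < rot d a 1 m'"
  using assms by (auto simp: rot_def)

text \<open>In the row that changes, \<open>z\<close> stands left of the winner, hence in the part
  fixed by the rotation.\<close>

lemma step_below:
  fixes p :: "('a::finite) perm_pair"
  assumes "is_perm p" "winner p b \<noteq> loser p b" "winner p b \<in> B"
    and less: "\<And>w. w \<in> B \<Longrightarrow> row p c z < row p c w"
    and "w \<in> B"
  shows "row (rauzy_step p b) c z < row (rauzy_step p b) c w"
proof (cases "c = b")
  case True
  then show ?thesis using less[OF \<open>w \<in> B\<close>] by (simp add: row_step_same)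
next
  case False
  then have c: "c = (\<not> b)" by auto
  show ?thesis
    using less[OF \<open>w \<in> B\<close>] less[OF assms(3)] winner_row_less[OF assms(1), of b] assms(2)
    unfolding c row_step_other[OF assms(1,2)] by (intro rot_less) auto
qed

text \<open>The bottom row is left free: in the induction it may end in letters outside
  \<open>B\<close>, such as the winner of a surrounding rotation.\<close>

definition top_final :: "('a::finite) set \<Rightarrow> 'a perm_pair \<Rightarrow> bool" where
  "top_final B p \<longleftrightarrow> (\<forall>z w. z \<notin> B \<longrightarrow> w \<in> B \<longrightarrow> row p True z < row p True w)"

lemma sweep_top_final:
  assumes "sweep B p Q p' K" "is_perm p" "top_final B p"
  shows "top_final B p'"
  using assms
proof (induction rule: sweep.induct)
  case (sweep_step p b)
  then show ?case unfolding top_final_def by (metis step_below)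
qed (auto dest: sweep_is_perm)

definition low :: "'a \<Rightarrow> ('a::finite) set \<Rightarrow> 'a perm_pair \<Rightarrow> bool" where
  "low z B p \<longleftrightarrow> (\<forall>c. \<forall>w\<in>B. row p c z < row p c w)"

text \<open>The loser is last in a row where \<open>z\<close> precedes the winner, so
  \<open>z\<close> never loses; a transposed step fixes the basis vector of every letter other than
  the loser.\<close>

lemma sweep_low:
  assumes "sweep B p Q p' K" "is_perm p" "low z B p"
  shows "low z B p' \<and> axis z 1 v* K = axis z (1::real)"
  using assms
proof (induction rule: sweep.induct)
  case (sweep_step p b)
  have "row p (\<not> b) z < row p (\<not> b) (winner p b)"
    using sweep_step by (auto simp: low_def)
  then have "z \<noteq> loser p b"
    using row_loser[OF sweep_step(3), of b] row_bounds(2)[OF sweep_step(3), of "\<not> b" "winner p b"] by auto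
  moreover have "low z B (rauzy_step p b)"
    using step_below[OF sweep_step(3,2,1)] sweep_step(4) unfolding low_def by blast
  ultimately show ?case
    using sweep_step by (simp add: theta_arrow_vmult axis_def vec_eq_iff)
next
  case (sweep_trans p Q p' K Q' p'' K')
  then show ?case
    using sweep_is_perm[OF sweep_trans.hyps(1)] by (simp add: vector_matrix_mul_assoc[symmetric])
qed auto

text \<open>Irreducibility of the pair of orders induced on \<open>B\<close>, phrased without
  positions so that it applies to blocks of a larger alphabet.\<close>

definition connected_on :: "('a::finite) set \<Rightarrow> 'a perm_pair \<Rightarrow> bool" where
  "connected_on B p \<longleftrightarrow> (\<forall>T. T \<subseteq> B \<longrightarrow> T \<noteq> {} \<longrightarrow> T \<noteq> B \<longrightarrow>
     (\<exists>c. \<exists>t\<in>T. \<exists>w\<in>B-T. row p c w < row p c t))"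

text \<open>Argued backwards: a set \<open>T\<close> preceding \<open>B - T\<close> in both rows
  after a step already did so before it. Such a \<open>T\<close> cannot contain the winner, which is
  last in its row.\<close>

lemma sweep_connected_on:
  assumes "sweep B p Q p' K" "is_perm p" "connected_on B p"
  shows "connected_on B p'"
  using assms
proof (induction rule: sweep.induct)
  case (sweep_step p b)
  note p = sweep_step(3) and wl = sweep_step(2)
  let ?p = "rauzy_step p b" and ?w = "winner p b"
  let ?a = "row p (\<not> b) ?w"
  have a: "?a < CARD('a)" using winner_row_less[OF p] wl by auto
  show ?case
    unfolding connected_on_def
  proof (intro allI impI)
    fix T assume T: "T \<subseteq> B" "T \<noteq> {}" "T \<noteq> B"
    show "\<exists>c. \<exists>t\<in>T. \<exists>u\<in>B-T. row ?p c u < row ?p c t"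
    proof (rule ccontr)
      assume neg: "\<not> ?thesis"
      have p': "is_perm ?p" using is_perm_step[OF p wl] .
      have init: "row ?p c t < row ?p c u" if "t \<in> T" "u \<in> B - T" for c t u
        using neg that row_eq_iff[OF p', of c t u] by (metis DiffD2 linorder_neqE_nat)
      obtain u where u: "u \<in> B - T" using T by blast
      have "?w \<notin> T"
      proof
        assume "?w \<in> T"
        then have "CARD('a) < row p b u"
          using init[OF _ u, of ?w b] row_winner[OF p, of b] by (simp add: row_step_same)
        then show False using row_bounds(2)[OF p, of b u] by simp
      qed
      then have wT: "?w \<in> B - T" using sweep_step by blast
      have "row p c t < row p c u" if t: "t \<in> T" and u: "u \<in> B - T" for c t u
      proof (rule bool_neq_cases[of "\<lambda>c. row p c t < row p c u" b])
        show "row p b t < row p b u" using init[OF t u, of b] by (simp add: row_step_same)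
        \<comment> \<open>After the step \<open>t\<close> precedes the winner, whose position is
          fixed, so the rotation did not move \<open>t\<close>.\<close>
        show "row p (\<not> b) t < row p (\<not> b) u"
          using init[OF t u, of "\<not> b"] init[OF t wT, of "\<not> b"] a
          unfolding row_step_other[OF p wl] by (auto simp: rot_def split: if_splits)
      qed
      then show False
        using sweep_step(4) T unfolding connected_on_def by (meson not_less_iff_gr_or_eq)
    qed
  qed
qed (auto dest: sweep_is_perm)

section \<open>Repeated operations and reversibility\<close>

lemma sweep_cyc:
  fixes p :: "('a::finite) perm_pair"
  assumes "is_perm p" "winner p b \<in> B" "row p (\<not> b) (winner p b) + k \<le> CARD('a)"
  shows "\<exists>K. sweep B p {} (cyc p b k) K \<and>
    (\<forall>z. row p (\<not> b) z + k \<le> CARD('a) \<longrightarrow> axis z 1 v* K = axis z (1::real))"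
  using assms(3)
proof (induction k)
  case 0
  then show ?case using sweep_refl[of B p] by auto
next
  case (Suc k)
  let ?p = "cyc p b k"
  have le: "row p (\<not> b) (winner p b) + k \<le> CARD('a)" using Suc.prems by simp
  note c = cyc[OF assms(1) le]
  obtain K where K: "sweep B p {} ?p K"
    "\<And>z. row p (\<not> b) z + k \<le> CARD('a) \<Longrightarrow> axis z 1 v* K = axis z (1::real)"
    using Suc by auto
  have "row ?p (\<not> b) (winner ?p b) < CARD('a)"
    unfolding c(3) unfolding c(4) using Suc.prems by (simp add: rot_def)
  then have wl: "winner ?p b \<noteq> loser ?p b"
    unfolding winner_row_less[OF c(1)] .
  have st: "sweep B ?p {} (rauzy_step ?p b) (theta_arrow ?p b)"
    using wl assms(2) c(3) by (intro sweep_step) auto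
  have "sweep B p {} (cyc p b (Suc k)) (theta_arrow ?p b ** K)"
    using sweep_trans[OF K(1) st] by simp
  \<comment> \<open>The loser of the next step started at position \<open>CARD('a) - k\<close>;
    letters that started further left have not lost yet.\<close>
  moreover have "axis z 1 v* (theta_arrow ?p b ** K) = axis z (1::real)"
    if z: "row p (\<not> b) z + Suc k \<le> CARD('a)" for z
  proof -
    have "row ?p (\<not> b) z < CARD('a)" unfolding c(4) using z Suc.prems by (auto simp: rot_def)
    then have "z \<noteq> loser ?p b" using row_loser[OF c(1), of b] by auto
    then have "axis z 1 v* theta_arrow ?p b = axis z (1::real)"
      by (simp add: theta_arrow_vmult[OF wl]) (simp add: axis_def vec_eq_iff)
    then show ?thesis using K(2)[of z] z by (simp add: vector_matrix_mul_assoc[symmetric])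
  qed
  ultimately show ?case by blast
qed

text \<open>A repeated operation runs through a cycle with constant winner, so a step is undone by
  completing its cycle, with all winners still in \<open>B\<close>.\<close>

lemma sweep_reverse:
  assumes "sweep B p Q p' K" "is_perm p"
  shows "\<exists>K'. sweep B p' {} p K'"
  using assms
proof (induction rule: sweep.induct)
  case (sweep_refl p)
  then show ?case using sweep.sweep_refl by blast
next
  case (sweep_loop p)
  then show ?case using sweep.sweep_refl by blast
next
  case (sweep_step p b)
  let ?a = "row p (\<not> b) (winner p b)" and ?p = "rauzy_step p b"
  have a: "?a < CARD('a)" using winner_row_less[OF sweep_step(3)] sweep_step by auto
  have p: "is_perm ?p" "winner ?p b = winner p b"
    using is_perm_step winner_step sweep_step by blast+
  have r: "row ?p (\<not> b) (winner p b) = ?a"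
    by (simp add: row_step_other[OF sweep_step(3,2)] rot_def)
  have "cyc ?p b (CARD('a) - ?a - 1) = cyc p b (Suc (CARD('a) - ?a - 1))"
    by (simp add: funpow_Suc_right del: funpow.simps)
  also have "Suc (CARD('a) - ?a - 1) = CARD('a) - ?a" using a by simp
  also have "cyc p b \<dots> = p" by (rule cyc_period[OF sweep_step(3)])
  finally show ?case
    using sweep_cyc[OF p(1), of b B "CARD('a) - ?a - 1"] a r sweep_step(1) p(2) by auto
next
  case (sweep_trans p Q p' K Q' p'' K')
  then obtain L L' where "sweep B p' {} p L" "sweep B p'' {} p' L'"
    using sweep_is_perm by blast
  then show ?case using sweep.sweep_trans[of B p'' "{}" p' L' "{}" p L] by auto
qed

lemma bring_last:
  fixes p :: "('a::finite) perm_pair"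
  assumes "is_perm p" "winner p b \<in> B" "row p (\<not> b) (winner p b) < row p (\<not> b) z"
  obtains p' K where "sweep B p {} p' K" "is_perm p'" "winner p' (\<not> b) = z"
    "row p' b = row p b" "winner p' b = winner p b"
    "\<And>u. row p (\<not> b) u \<le> row p (\<not> b) (winner p b) \<Longrightarrow> row p' (\<not> b) u = row p (\<not> b) u"
proof -
  let ?k = "CARD('a) - row p (\<not> b) z"
  have le: "row p (\<not> b) (winner p b) + ?k \<le> CARD('a)"
    using assms(3) row_bounds[OF assms(1), of "\<not> b" z] by simp
  note c = cyc[OF assms(1) le]
  obtain K where K: "sweep B p {} (cyc p b ?k) K" using sweep_cyc[OF assms(1,2) le] by blast
  have "row (cyc p b ?k) (\<not> b) z = CARD('a)"
    unfolding c(4) using assms(3) row_bounds[OF assms(1), of "\<not> b" z] by (simp add: rot_def)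
  then have "winner (cyc p b ?k) (\<not> b) = z" using winner_eqI[OF c(1)] by blast
  moreover have "row (cyc p b ?k) (\<not> b) u = row p (\<not> b) u"
    if "row p (\<not> b) u \<le> row p (\<not> b) (winner p b)" for u
    unfolding c(4) using that by (simp add: rot_def)
  ultimately show thesis using that[OF K c(1) _ c(2,3)] by blast
qed

subsection \<open>Lagrangian families\<close>

text \<open>Isotropic and coisotropic, in a form that is insensitive to the radical of \<open>Omega p\<close> on \<open>supp B\<close>.\<close>
definition lagr :: "('a::finite) set \<Rightarrow> 'a perm_pair \<Rightarrow> (real^'a) set \<Rightarrow> bool" where
  "lagr B p Q \<longleftrightarrow> Q \<subseteq> supp B \<and> (\<forall>q\<in>Q. \<forall>q'\<in>Q. q \<bullet> (Omega p *v q') = 0) \<and>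
    (\<forall>u\<in>supp B. \<forall>v\<in>supp B. (\<forall>q\<in>Q. q \<bullet> (Omega p *v u) = 0) \<longrightarrow>
      (\<forall>q\<in>Q. q \<bullet> (Omega p *v v) = 0) \<longrightarrow> u \<bullet> (Omega p *v v) = 0)"

lemma lagr_supp: "lagr B p Q \<Longrightarrow> q \<in> Q \<Longrightarrow> q \<in> supp B"
  unfolding lagr_def by (elim conjE) (rule subsetD)

lemma lagr_isotropic: "lagr B p Q \<Longrightarrow> q \<in> Q \<Longrightarrow> q' \<in> Q \<Longrightarrow> q \<bullet> (Omega p *v q') = 0"
  unfolding lagr_def by (elim conjE) (rule bspec, rule bspec)

lemma lagr_coisotropic:
  assumes "lagr B p Q" "u \<in> supp B" "v \<in> supp B" "\<And>q. q \<in> Q \<Longrightarrow> q \<bullet> (Omega p *v u) = 0"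
    "\<And>q. q \<in> Q \<Longrightarrow> q \<bullet> (Omega p *v v) = 0"
  shows "u \<bullet> (Omega p *v v) = 0"
  using assms unfolding lagr_def by simp

lemma lagrI:
  assumes "\<And>q. q \<in> Q \<Longrightarrow> q \<in> supp B" "\<And>q q'. q \<in> Q \<Longrightarrow> q' \<in> Q \<Longrightarrow> q \<bullet> (Omega p *v q') = 0"
    "\<And>u v. u \<in> supp B \<Longrightarrow> v \<in> supp B \<Longrightarrow> (\<And>q. q \<in> Q \<Longrightarrow> q \<bullet> (Omega p *v u) = 0) \<Longrightarrow>
      (\<And>q. q \<in> Q \<Longrightarrow> q \<bullet> (Omega p *v v) = 0) \<Longrightarrow> u \<bullet> (Omega p *v v) = 0"
  shows "lagr B p Q"
  using assms unfolding lagr_def by (simp add: subset_iff)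

lemma sweep_form:
  assumes "sweep B p Q p' K" "is_perm p"
  shows "u \<bullet> (Omega p' *v v) = (u v* K) \<bullet> (Omega p *v (v v* K))"
  using sweep_Omega[OF assms] by (simp add: dot_lmul_matrix)

text \<open>The transpose of \<open>K\<close> maps \<open>supp B\<close> bijectively to itself and
  carries the form at \<open>p'\<close> to the form at \<open>p\<close>; \<open>J\<close> moves the
  test vectors of coisotropy back.\<close>

lemma lagr_pullback:
  assumes sw: "sweep B p P p' K" and p: "is_perm p" and l: "lagr B p' Q"
  shows "lagr B p ((\<lambda>q. q v* K) ` Q)"
proof -
  note f = sweep_form[OF sw p]
  obtain J where K: "\<And>v. v \<in> supp B \<Longrightarrow> v v* K \<in> supp B" and J: "J ** K = mat 1"
    "\<And>v. v \<in> supp B \<Longrightarrow> v v* J \<in> supp B"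
    using sweep_inverse[OF sw] by blast
  have JK: "(v v* J) v* K = v" for v by (simp add: vector_matrix_mul_assoc J)
  have "u \<bullet> (Omega p *v v) = 0"
    if "u \<in> supp B" "v \<in> supp B" "\<forall>q\<in>Q. (q v* K) \<bullet> (Omega p *v u) = 0"
      "\<forall>q\<in>Q. (q v* K) \<bullet> (Omega p *v v) = 0" for u v
  proof -
    have "q \<bullet> (Omega p' *v (u v* J)) = 0" "q \<bullet> (Omega p' *v (v v* J)) = 0" if "q \<in> Q" for q
      unfolding f JK using \<open>\<forall>q\<in>Q. (q v* K) \<bullet> (Omega p *v u) = 0\<close>
        \<open>\<forall>q\<in>Q. (q v* K) \<bullet> (Omega p *v v) = 0\<close> that by auto
    then have "(u v* J) \<bullet> (Omega p' *v (v v* J)) = 0"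
      by (rule lagr_coisotropic[OF l J(2)[OF that(1)] J(2)[OF that(2)]])
    then show ?thesis unfolding f JK .
  qed
  moreover have "(q v* K) \<bullet> (Omega p *v (q' v* K)) = 0" if "q \<in> Q" "q' \<in> Q" for q q'
    using l that unfolding lagr_def f[symmetric] by blast
  moreover have "(\<lambda>q. q v* K) ` Q \<subseteq> supp B" using l K unfolding lagr_def by blast
  ultimately show ?thesis unfolding lagr_def by auto
qed

lemma supp_fixed:
  assumes "\<And>z. z \<in> D \<Longrightarrow> axis z 1 v* K = axis z (1::real)" "u \<in> supp D"
  shows "u v* K = u"
proof (rule vec_eq_iff[THEN iffD2], rule allI)
  fix j
  have ent: "(axis i 1 v* K) $ j = K $ i $ j" for i
    using dot_lmul_matrix[of "axis i 1" K "axis j 1"]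
    by (simp add: inner_axis inner_axis' matrix_vector_mult_basis column_def)
  have "(u v* K) $ j = (\<Sum>i\<in>UNIV. if i = j then u $ i else 0)"
    unfolding vector_matrix_mult_def
  proof (simp only: vec_lambda_beta, rule sum.cong[OF refl])
    fix i
    show "u $ i * K $ i $ j = (if i = j then u $ i else 0)"
      using assms ent[of i] by (cases "i \<in> D") (auto simp: supp_def axis_def)
  qed
  then show "(u v* K) $ j = u $ j" by simp
qed

text \<open>The transpose of \<open>K\<close> fixes \<open>supp D\<close> pointwise, so the forms at
  \<open>p\<close> and \<open>p'\<close> agree there. A family found for a block later on the path
  can thus be used unchanged at its start.\<close>

lemma lagr_restrict:
  assumes sw: "sweep B p P p' K" and p: "is_perm p" and l: "lagr D p' Q"
    and D: "\<And>z. z \<in> D \<Longrightarrow> axis z 1 v* K = axis z (1::real)"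
  shows "lagr D p Q" "(\<lambda>q. q v* K) ` Q = Q"
proof -
  have fx: "u v* K = u" if "u \<in> supp D" for u using supp_fixed[OF D that] .
  have f: "u \<bullet> (Omega p' *v v) = u \<bullet> (Omega p *v v)" if "u \<in> supp D" "v \<in> supp D" for u v
    using sweep_form[OF sw p, of u v] fx that by simp
  have Q: "q \<in> supp D" if "q \<in> Q" for q using l that unfolding lagr_def by blast
  show "(\<lambda>q. q v* K) ` Q = Q" using fx Q by force
  show "lagr D p Q"
    using l Q unfolding lagr_def by (simp add: f)
qed

lemma supp_orth:
  assumes "u \<in> supp D" "v \<in> supp E" "\<And>z w. z \<in> D \<Longrightarrow> w \<in> E \<Longrightarrow> Omega p $ z $ w = 0"
  shows "u \<bullet> (Omega p *v v) = 0"
proof -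
  have 0: "u $ i * (Omega p $ i $ j * v $ j) = 0" for i j
    using assms by (cases "i \<in> D"; cases "j \<in> E") (auto simp: supp_def)
  have 1: "u $ i * (Omega p *v v) $ i = 0" for i
    by (simp only: matrix_vector_mult_def vec_lambda_beta sum_distrib_left 0 sum.neutral_const)
  show ?thesis by (simp only: inner_vec_def inner_real_def 1 sum.neutral_const)
qed

lemma lagr_empty: "lagr {} p {}"
  by (auto simp: lagr_def intro: supp_orth)

lemma lagr_singleton: "Q \<subseteq> supp {z} \<Longrightarrow> lagr {z} p Q"
  by (auto simp: lagr_def Omega_nth intro!: supp_orth[of _ "{z}" _ "{z}"])

lemma supp_mono: "B \<subseteq> C \<Longrightarrow> supp B \<subseteq> supp C"
  by (auto simp: supp_def)

lemma lagr_union: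
  assumes l: "lagr D p Q" "lagr E p R"
    and orth: "\<And>z w. z \<in> D \<Longrightarrow> w \<in> E \<Longrightarrow> Omega p $ z $ w = 0"
  shows "lagr (D \<union> E) p (Q \<union> R)"
proof -
  have orth': "Omega p $ w $ z = 0" if "z \<in> D" "w \<in> E" for z w
    using orth[OF that] Omega_antisym[of p z w] by simp
  have QR: "Q \<subseteq> supp D" "R \<subseteq> supp E" using l by (auto simp: lagr_def)
  have DE: "x \<bullet> (Omega p *v y) = 0" if "x \<in> supp D" "y \<in> supp E" for x y
    using supp_orth[OF that orth] .
  have ED: "x \<bullet> (Omega p *v y) = 0" if "x \<in> supp E" "y \<in> supp D" for x y
    using supp_orth[OF that orth'] .
  have split: "\<exists>x y. u = x + y \<and> x \<in> supp D \<and> y \<in> supp E" if "u \<in> supp (D \<union> E)" for u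
    using that
    by (intro exI[of _ "\<chi> i. if i \<in> D then u $ i else 0"] exI[of _ "\<chi> i. if i \<in> D then 0 else u $ i"])
      (auto simp: supp_def vec_eq_iff)
  have c: "u \<bullet> (Omega p *v v) = 0"
    if uv: "u \<in> supp (D \<union> E)" "v \<in> supp (D \<union> E)" and perp: "\<And>q. q \<in> Q\<union>R \<Longrightarrow> q \<bullet> (Omega p *v u) = 0"
      "\<And>q. q \<in> Q\<union>R \<Longrightarrow> q \<bullet> (Omega p *v v) = 0" for u v
  proof -
    obtain x y x' y' where u: "u = x + y" "x \<in> supp D" "y \<in> supp E"
      and v: "v = x' + y'" "x' \<in> supp D" "y' \<in> supp E" using split uv by meson
    have "q \<bullet> (Omega p *v x) = 0" "q \<bullet> (Omega p *v x') = 0" if "q \<in> Q" for q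
      using perp(1)[of q] perp(2)[of q] DE[of q y] DE[of q y'] u v QR that
      by (auto simp: matrix_vector_right_distrib inner_add_right)
    moreover have "q \<bullet> (Omega p *v y) = 0" "q \<bullet> (Omega p *v y') = 0" if "q \<in> R" for q
      using perp(1)[of q] perp(2)[of q] ED[of q x] ED[of q x'] u v QR that
      by (auto simp: matrix_vector_right_distrib inner_add_right)
    ultimately have "x \<bullet> (Omega p *v x') = 0" "y \<bullet> (Omega p *v y') = 0"
      using lagr_coisotropic[OF l(1) u(2) v(2)] lagr_coisotropic[OF l(2) u(3) v(3)] by simp_all
    then show ?thesis
      unfolding u(1) v(1) using DE[OF u(2) v(3)] ED[OF u(3) v(2)]
      by (simp add: matrix_vector_right_distrib inner_add_right inner_add_left)
  qed
  have i: "q \<bullet> (Omega p *v q') = 0" if "q \<in> Q \<union> R" "q' \<in> Q \<union> R" for q q'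
    using that lagr_isotropic[OF l(1), of q q'] lagr_isotropic[OF l(2), of q q'] DE[of q q'] ED[of q q'] QR
    by auto
  have s: "q \<in> supp (D \<union> E)" if "q \<in> Q \<union> R" for q
    using that QR supp_mono[of D "D \<union> E"] supp_mono[of E "D \<union> E"] by blast
  show ?thesis by (rule lagrI[OF s i c])
qed

text \<open>Among the letters considered, \<open>Z\<close> pairs with \<open>A\<close> alone, so
  orthogonality to \<open>axis Z 1\<close> kills the \<open>A\<close>-coordinate. On what remains,
  \<open>supp (insert Z D)\<close>, the vector \<open>axis Z 1\<close> is in the radical. The
  pairing of \<open>A\<close> with \<open>D\<close> is arbitrary.\<close>

lemma lagr_add_pair:
  assumes l: "lagr D p Q" and AZ: "A \<noteq> Z"
    and orth: "\<And>z. z \<in> D \<Longrightarrow> Omega p $ Z $ z = 0" and nz: "Omega p $ Z $ A \<noteq> 0"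
  shows "lagr (insert A (insert Z D)) p (insert (axis Z 1) Q)"
proof -
  have eZ: "axis Z 1 \<in> supp {Z}" by (simp add: supp_def axis_def)
  have l': "lagr (insert Z D) p (insert (axis Z 1) Q)"
    using lagr_union[OF lagr_singleton[of "{axis Z 1}" Z p] l] eZ orth by simp
  have "u \<in> supp (insert Z D)"
    if u: "u \<in> supp (insert A (insert Z D))" and "axis Z 1 \<bullet> (Omega p *v u) = 0" for u
  proof -
    have e: "Omega p $ Z $ j * u $ j = (if j = A then Omega p $ Z $ A * u $ A else 0)" for j
      using u orth[of j] by (auto simp: supp_def Omega_nth)
    have "(Omega p *v u) $ Z = (\<Sum>j\<in>UNIV. if j = A then Omega p $ Z $ A * u $ A else 0)"
      unfolding matrix_vector_mult_def vec_lambda_beta by (intro sum.cong refl e)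
    then have "(Omega p *v u) $ Z = Omega p $ Z $ A * u $ A" by simp
    then have "u $ A = 0" using that(2) nz by (simp add: inner_axis')
    then show ?thesis using u AZ by (auto simp: supp_def)
  qed
  then have red: "u \<in> supp (insert Z D)" if "u \<in> supp (insert A (insert Z D))"
    "\<And>q. q \<in> insert (axis Z 1) Q \<Longrightarrow> q \<bullet> (Omega p *v u) = 0" for u
    using that by blast
  show ?thesis
  proof (rule lagrI)
    show "q \<in> supp (insert A (insert Z D))" if "q \<in> insert (axis Z 1) Q" for q
      using lagr_supp[OF l' that] supp_mono[of "insert Z D" "insert A (insert Z D)"] by blast
    show "q \<bullet> (Omega p *v q') = 0" if "q \<in> insert (axis Z 1) Q" "q' \<in> insert (axis Z 1) Q" for q q'
      using lagr_isotropic[OF l' that] .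
    show "u \<bullet> (Omega p *v v) = 0"
      if "u \<in> supp (insert A (insert Z D))" "v \<in> supp (insert A (insert Z D))"
        and u: "\<And>q. q \<in> insert (axis Z 1) Q \<Longrightarrow> q \<bullet> (Omega p *v u) = 0"
        and v: "\<And>q. q \<in> insert (axis Z 1) Q \<Longrightarrow> q \<bullet> (Omega p *v v) = 0" for u v
      by (rule lagr_coisotropic[OF l' red red u v]) (use that in auto)
  qed
qed

section \<open>Final segments of a row as intervals of positions\<close>

lemma final_iff:
  fixes p :: "('a::finite) perm_pair"
  assumes p: "is_perm p" and D: "\<And>z w. z \<notin> D \<Longrightarrow> w \<in> D \<Longrightarrow> row p c z < row p c w"
  shows "z \<in> D \<longleftrightarrow> CARD('a) < row p c z + card D"
proof -
  let ?f = "row p c"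
  have cd: "card {w. m < ?f w} = CARD('a) - m" for m
  proof -
    have "bij_betw ?f UNIV {1..CARD('a)}" using p is_perm_row by blast
    moreover have "?f ` {w. m < ?f w} = {x\<in>range ?f. m < x}" by auto
    moreover have "\<dots> = {m<..CARD('a)}"
      using \<open>bij_betw ?f UNIV {1..CARD('a)}\<close> by (auto simp: bij_betw_def)
    ultimately have "bij_betw ?f {w. m < ?f w} {m<..CARD('a)}"
      by (metis bij_betw_subset subset_UNIV)
    then show ?thesis by (metis bij_betw_same_card card_greaterThanAtMost)
  qed
  have sub: "D \<subseteq> {w. CARD('a) - card D < ?f w}"
  proof
    fix z assume z: "z \<in> D"
    have "{w. ?f z - 1 < ?f w} \<subseteq> D"
      using D[OF _ z] row_bounds(1)[OF p, of c z] by force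
    then have "CARD('a) - (?f z - 1) \<le> card D" using cd by (metis card_mono finite)
    then show "z \<in> {w. CARD('a) - card D < ?f w}"
      using row_bounds(1)[OF p, of c z] by auto
  qed
  have "card D \<le> CARD('a)" by (simp add: card_mono)
  then have "D = {w. CARD('a) - card D < ?f w}"
    using sub cd[of "CARD('a) - card D"] by (intro card_subset_eq) auto
  then have "z \<in> D \<longleftrightarrow> CARD('a) - card D < ?f z" by blast
  then show ?thesis using \<open>card D \<le> CARD('a)\<close> by auto
qed

lemma top_final_iff:
  fixes p :: "('a::finite) perm_pair"
  assumes "is_perm p" "top_final D p"
  shows "z \<in> D \<longleftrightarrow> CARD('a) < row p True z + card D"
  using final_iff[OF assms(1), of D True z] assms(2) unfolding top_final_def by blast

lemma rot_less_low:
  assumes "m < m'" "m' + k \<le> d"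
  shows "rot d a k m < rot d a k m'"
  using assms by (auto simp: rot_def)

subsection \<open>Existence of Lagrangian sweeps\<close>

text \<open>When \<open>D\<close> ends the top row and the last bottom letter is outside
  \<open>D\<close>, the rotation carries \<open>D\<close> to just right of that letter. The clause
  on \<open>low\<close> letters allows one more transvection vector to be added afterwards and
  pulled back unchanged.\<close>

definition rotating_sweep :: "('a::finite) set \<Rightarrow> 'a perm_pair \<Rightarrow> bool" where
  "rotating_sweep D p \<longleftrightarrow> (\<exists>Q K. sweep (insert (winner p False) D) p Q (cyc p False (card D)) K \<and>
     lagr D p Q \<and> (\<forall>z. low z D p \<longrightarrow> axis z 1 v* K = axis z (1::real)))"

definition closed_sweep :: "('a::finite) set \<Rightarrow> 'a perm_pair \<Rightarrow> bool" where
  "closed_sweep B p \<longleftrightarrow> (\<exists>Q K. sweep B p Q p K \<and> lagr B p Q)"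

lemma top_final_winner:
  fixes p :: "('a::finite) perm_pair"
  assumes "is_perm p" "top_final B p" "B \<noteq> {}"
  shows "winner p True \<in> B"
proof (rule ccontr)
  assume "winner p True \<notin> B"
  then obtain w where "row p True (winner p True) < row p True w"
    using assms unfolding top_final_def by blast
  then show False using row_winner[OF assms(1)] row_bounds(2)[OF assms(1), of True w] by simp
qed

lemma row_less_winner:
  assumes "is_perm p" "x \<noteq> winner p c"
  shows "row p c x < row p c (winner p c)"
  using row_less_card[OF assms] row_winner[OF assms(1)] by simp

text \<open>By connectedness the last top letter has some letter of \<open>B\<close> to its right in
  the bottom row; rotate that letter to the end.\<close>

lemma sweep_last_bot_in:
  fixes p :: "('a::finite) perm_pair"
  assumes p: "is_perm p" "top_final B p" "connected_on B p" and B: "2 \<le> card B"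
  obtains p' K where "sweep B p {} p' K" "winner p' False \<in> B"
proof -
  let ?x = "winner p True"
  have "B \<noteq> {}" using B by auto
  then have x: "?x \<in> B" using top_final_winner[OF p(1,2)] by blast
  have "B - {?x} \<noteq> {}"
  proof
    assume "B - {?x} = {}"
    then have "B \<subseteq> {?x}" by blast
    then show False using B card_mono[of "{?x}" B] by simp
  qed
  moreover have "B - {?x} \<noteq> B" "B - {?x} \<subseteq> B" using x by auto
  ultimately obtain c t w where "t \<in> B - {?x}" "w \<in> B - (B - {?x})" and lt: "row p c w < row p c t"
    using p(3) unfolding connected_on_def by meson
  then have w: "w = ?x" and t: "t \<in> B" by auto
  have "c = False"
    using lt row_winner[OF p(1), of True] row_bounds(2)[OF p(1), of True t] w by (cases c) auto
  then have "row p (\<not> True) ?x < row p (\<not> True) t" using lt w by simp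
  from bring_last[OF p(1) x this] obtain p' K where "sweep B p {} p' K" "winner p' (\<not> True) = t"
    by metis
  then show thesis using that t by simp
qed

lemma sweep_trans_empty:
  assumes "sweep B p {} p' K" "sweep B p' {} p'' K'"
  shows "sweep B p {} p'' (K' ** K)"
  using sweep_trans[OF assms] by simp

text \<open>Rauzy's argument that every class contains a standard permutation: among the reachable
  permutations whose bottom row ends in a letter of \<open>B\<close>, take one where this letter is leftmost in the
  top row.\<close>
lemma sweep_standard:
  fixes p :: "('a::finite) perm_pair"
  assumes p: "is_perm p" "top_final B p" "connected_on B p" and B: "2 \<le> card B"
  obtains p' K where "sweep B p {} p' K" "winner p' False \<in> B"
    "\<And>w. w \<in> B \<Longrightarrow> row p' True (winner p' False) \<le> row p' True w"
proof -
  define R where "R q \<longleftrightarrow> (\<exists>K. sweep B p {} q K) \<and> winner q False \<in> B" for q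
  obtain p0 where "R p0" using sweep_last_bot_in[OF assms] unfolding R_def by metis
  define q where "q = arg_min (\<lambda>q. row q True (winner q False)) R"
  have q: "R q" and q_min: "\<And>r. R r \<Longrightarrow> row q True (winner q False) \<le> row r True (winner r False)"
    using arg_min_nat_lemma[of R p0 "\<lambda>q. row q True (winner q False)"] \<open>R p0\<close> unfolding q_def by auto
  let ?y = "winner q False"
  obtain K where K: "sweep B p {} q K" and y: "?y \<in> B" using q unfolding R_def by blast
  have qp: "is_perm q" using sweep_is_perm[OF K p(1)] .
  have qc: "connected_on B q" using sweep_connected_on[OF K p(1,3)] .
  show thesis
  proof (rule that[OF K y], rule ccontr)
    fix w0 assume w0: "w0 \<in> B" "\<not> row q True ?y \<le> row q True w0"
    define T where "T = {z\<in>B. row q True z < row q True ?y}"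
    have T: "T \<subseteq> B" "T \<noteq> {}" "T \<noteq> B" using w0 y unfolding T_def by auto
    then obtain c t w where t: "t \<in> T" and w: "w \<in> B - T" and lt: "row q c w < row q c t"
      using qc unfolding connected_on_def by meson
    have tw: "row q True t < row q True ?y" "row q True ?y \<le> row q True w"
      using t w unfolding T_def by auto
    then have "c = False" using lt by (cases c) auto
    then have lt: "row q False w < row q False t" using lt by simp
    have "w \<noteq> ?y" using lt row_winner[OF qp, of False] row_bounds(2)[OF qp, of False t] by auto
    then have "row q True ?y < row q True w" using tw(2) row_eq_iff[OF qp, of True ?y w] by simp
    then have "row q (\<not> False) ?y < row q (\<not> False) w" by simp
    \<comment> \<open>Rotate \<open>w\<close> to the end of the top row, then \<open>t\<close>,
      which follows \<open>w\<close> in the bottom row, to the end of the bottom row. The top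
      position of \<open>t\<close> stays left of that of \<open>?y\<close>, against
      minimality.\<close>
    from bring_last[OF qp y this] obtain r K1 where r: "sweep B q {} r K1" "is_perm r"
      "winner r (\<not> False) = w" "row r False = row q False"
      "\<And>u. row q (\<not> False) u \<le> row q (\<not> False) ?y \<Longrightarrow> row r (\<not> False) u = row q (\<not> False) u"
      by blast
    note r = r[simplified]
    have "row r (\<not> True) (winner r True) < row r (\<not> True) t" "winner r True \<in> B"
      using lt r(3,4) w by auto
    from bring_last[OF r(2) this(2,1)] obtain s K2 where s: "sweep B r {} s K2"
      "winner s (\<not> True) = t" "row s True = row r True"
      by metis
    have "R s"
      unfolding R_def using sweep_trans_empty[OF sweep_trans_empty[OF K r(1)] s(1)] s(2) t T(1) by auto
    moreover have "row s True (winner s False) = row q True t" using s r(5)[of t] tw by simp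
    ultimately show False using q_min[of s] tw(1) by simp
  qed
qed

lemma top_final_remove_first:
  fixes p :: "('a::finite) perm_pair"
  assumes "is_perm p" "top_final B p" "A \<in> B" "\<And>w. w \<in> B \<Longrightarrow> row p True A \<le> row p True w"
  shows "top_final (B - {A}) p" "row p True A + card B = CARD('a) + 1"
proof -
  show *: "top_final (B - {A}) p"
    unfolding top_final_def
  proof (intro allI impI)
    fix z w assume z: "z \<notin> B - {A}" and w: "w \<in> B - {A}"
    show "row p True z < row p True w"
    proof (cases "z = A")
      case True
      then show ?thesis using assms(4)[of w] w row_eq_iff[OF assms(1), of True A w] by force
    next
      case False
      then show ?thesis using z w assms(2) unfolding top_final_def by blast
    qed
  qed
  have "card (B - {A}) = card B - 1" "card B > 0"
    using assms(3) by (auto simp: card_gt_0_iff)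
  then show "row p True A + card B = CARD('a) + 1"
    using top_final_iff[OF assms(1,2), of A] top_final_iff[OF assms(1) *, of A] assms(3) by auto
qed

text \<open>One half of a joint induction on the number of letters; the other half,
  \<open>rotating_sweep\<close>, applies this to irreducible blocks. Here \<open>A\<close> and
  \<open>Z\<close> become the pair of \<open>lagr_add_pair\<close>, and the other letters of
  \<open>B\<close> are left to \<open>IH\<close>.\<close>

lemma closed_sweep_step:
  fixes p :: "('a::finite) perm_pair"
  assumes p: "is_perm p" "top_final B p" "connected_on B p" "B \<noteq> {}"
    and IH: "\<And>D q. card D < card B \<Longrightarrow> is_perm q \<Longrightarrow> top_final D q \<Longrightarrow> winner q False \<notin> D \<Longrightarrow>
      rotating_sweep D (q :: 'a perm_pair)"
  shows "closed_sweep B p"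
proof (cases "card B = 1")
  case True
  then obtain z where "B = {z}" by (meson card_1_singletonE)
  then show ?thesis
    using sweep_refl[of B p] lagr_singleton[of "{}" z p] unfolding closed_sweep_def by blast
next
  case False
  then have B2: "2 \<le> card B" using p(4) by (metis One_nat_def Suc_leI card_gt_0_iff finite le_neq_implies_less numeral_2_eq_2)
  obtain p1 K1 where p1: "sweep B p {} p1 K1" "winner p1 False \<in> B"
    "\<And>w. w \<in> B \<Longrightarrow> row p1 True (winner p1 False) \<le> row p1 True w"
    using sweep_standard[OF p(1-3) B2] by blast
  define A where "A = winner p1 False"
  have p1p: "is_perm p1" using sweep_is_perm[OF p1(1) p(1)] .
  have p1f: "top_final B p1" using sweep_top_final[OF p1(1) p(1,2)] .
  note first = top_final_remove_first[OF p1p p1f p1(2,3), folded A_def]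
  have AB: "A \<in> B" using p1(2) by (simp add: A_def)
  obtain Z where Z: "Z \<in> B" "\<And>w. w \<in> B \<Longrightarrow> row p1 False Z \<le> row p1 False w"
    using p(4) finite[of B] by (metis arg_min_if_finite(1) arg_min_least)
  have "A \<noteq> Z"
  proof
    assume "A = Z"
    have "w = A" if "w \<in> B" for w
      using Z(2)[OF that] row_winner[OF p1p, of False] row_less_card[OF p1p, of w False] \<open>A = Z\<close>
      by (fastforce simp: A_def)
    then have "B \<subseteq> {A}" by blast
    then show False using B2 card_mono[of "{A}" B] by simp
  qed
  \<comment> \<open>A shift by \<open>?k\<close> takes \<open>Z\<close> one place past the end, that
    is, to position \<open>?a + 1\<close> just right of \<open>A\<close>.\<close>
  let ?a = "row p1 True A" and ?k = "CARD('a) + 1 - row p1 True Z"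
  have aZ: "?a < row p1 True Z"
    using p1(3)[OF Z(1)] \<open>A \<noteq> Z\<close> row_eq_iff[OF p1p, of True A Z] by (simp add: A_def)
  have k: "row p1 (\<not> False) (winner p1 False) + ?k \<le> CARD('a)"
    using aZ row_bounds(2)[OF p1p, of True Z] by (simp add: A_def)
  define p2 where "p2 = cyc p1 False ?k"
  note c = cyc[OF p1p k, folded p2_def, simplified, folded A_def]
  obtain K2 where K2: "sweep B p1 {} p2 K2"
    using sweep_cyc[OF p1p p1(2) k] unfolding p2_def by blast
  have A2: "row p2 True A = ?a" unfolding c(4) by (simp add: rot_def)
  have Z2: "row p2 True Z = ?a + 1"
    unfolding c(4) using aZ k row_bounds(2)[OF p1p, of True Z] by (simp add: rot_def A_def)
  have gt2: "?a < row p2 True w" if "w \<in> B" "w \<noteq> A" for w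
  proof -
    have "?a < row p1 True w"
      using first(1) that unfolding top_final_def by blast
    then show ?thesis unfolding c(4) using k by (auto simp: rot_def A_def)
  qed
  define D where "D = B - {A, Z}"
  have gtZ: "row p2 True Z < row p2 True w" if "w \<in> D" for w
    using gt2[of w] row_eq_iff[OF c(1), of True Z w] that Z2 unfolding D_def by force
  have "row p2 False Z < row p2 False w" if "w \<in> D" for w
    using Z(2)[of w] row_eq_iff[OF p1p, of False Z w] that unfolding c(2) D_def by force
  then have lowZ: "low Z D p2" using gtZ unfolding low_def by (metis (full_types))
  have p2f: "top_final B p2" using sweep_top_final[OF K2 p1p p1f] .
  have Df: "top_final D p2"
    unfolding top_final_def
  proof (intro allI impI)
    fix z w assume z: "z \<notin> D" and w: "w \<in> D"
    consider "z = A" | "z = Z" | "z \<notin> B" using z unfolding D_def by blast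
    then show "row p2 True z < row p2 True w"
    proof cases
      case 1
      then show ?thesis using gtZ[OF w] Z2 A2 by simp
    next
      case 2
      then show ?thesis using gtZ[OF w] by simp
    next
      case 3
      then show ?thesis using w p2f unfolding top_final_def D_def by blast
    qed
  qed
  have cD: "card D + 2 = card B"
    using AB Z(1) \<open>A \<noteq> Z\<close> B2 unfolding D_def by (simp add: card_Diff_subset)
  have "rotating_sweep D p2"
    using IH[OF _ c(1) Df] cD c(3) unfolding D_def by (auto simp: D_def)
  then obtain Q K3 where K3: "sweep (insert A D) p2 Q (cyc p2 False (card D)) K3" "lagr D p2 Q"
    "\<And>z. low z D p2 \<Longrightarrow> axis z 1 v* K3 = axis z (1::real)"
    unfolding rotating_sweep_def c(3) by blast
  define p3 where "p3 = cyc p2 False (card D)"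
  have k3: "row p2 (\<not> False) (winner p2 False) + card D \<le> CARD('a)"
    using first(2) cD A2 c(3) by simp
  note c3 = cyc[OF c(1) k3, folded p3_def, simplified, unfolded c(3)]
  \<comment> \<open>\<open>Z\<close> stood at position \<open>CARD('a) - card D\<close>, so the
    rotation by \<open>card D\<close> makes it the last top letter.\<close>
  have "row p3 True Z = CARD('a)"
    unfolding c3(4) Z2 A2 using first(2) cD by (simp add: rot_def)
  then have wZ: "winner p3 True = Z" using winner_eqI[OF c3(1)] by blast
  have s3: "sweep B p2 Q p3 K3"
    using sweep_mono[OF K3(1), of B] AB unfolding p3_def D_def by blast
  have s4: "sweep B p3 {axis Z 1} p3 (mat 1)"
    using sweep_loop[of p3 B] wZ Z(1) by simp
  \<comment> \<open>As \<open>Z\<close> is low for \<open>D\<close>, the new vector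
    \<open>axis Z 1\<close> pulls back from \<open>p3\<close> to \<open>p2\<close> as
    itself.\<close>
  have s34: "sweep B p2 (insert (axis Z 1) Q) p3 K3"
    using sweep_trans[OF s3 s4] K3(3)[OF lowZ] by simp
  have "Omega p2 $ Z $ z = 0" if "z \<in> D" for z
  proof -
    have "row p2 c Z < row p2 c z" for c using lowZ that unfolding low_def by blast
    from this[of True] this[of False] show ?thesis by (simp add: Omega_nth)
  qed
  moreover have "Omega p2 $ Z $ A \<noteq> 0"
    using A2 Z2 row_less_winner[OF p1p, of Z False] \<open>A \<noteq> Z\<close> c(2)
    by (simp add: Omega_nth A_def)
  ultimately have "lagr (insert A (insert Z D)) p2 (insert (axis Z 1) Q)"
    by (intro lagr_add_pair[OF K3(2) \<open>A \<noteq> Z\<close>])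
  moreover have "insert A (insert Z D) = B" using AB Z(1) unfolding D_def by blast
  ultimately have l2: "lagr B p2 (insert (axis Z 1) Q)" by simp
  have s2: "sweep B p {} p2 (K2 ** K1)" using sweep_trans_empty[OF p1(1) K2] .
  have s: "sweep B p ((\<lambda>q. q v* (K2 ** K1)) ` (insert (axis Z 1) Q)) p3 (K3 ** (K2 ** K1))"
    using sweep_trans[OF s2 s34] by simp
  obtain J where "sweep B p3 {} p J" using sweep_reverse[OF s p(1)] by blast
  from sweep_trans[OF s this] show ?thesis
    using lagr_pullback[OF s2 p(1) l2] unfolding closed_sweep_def by auto
qed

text \<open>The rightmost irreducible component of \<open>D\<close>: a nonempty subset that is final
  in both rows and of least cardinality is connected, since removing an initial part would leave a
  smaller one.\<close>

lemma top_block: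
  fixes p :: "('a::finite) perm_pair"
  assumes p: "is_perm p" and D: "D \<noteq> {}"
  obtains E where "E \<subseteq> D" "E \<noteq> {}" "connected_on E p"
    "\<And>z w c. z \<in> D - E \<Longrightarrow> w \<in> E \<Longrightarrow> row p c z < row p c w"
proof -
  define U where "U E \<longleftrightarrow> E \<subseteq> D \<and> E \<noteq> {} \<and> (\<forall>z\<in>D-E. \<forall>w\<in>E. \<forall>c. row p c z < row p c w)" for E
  define E where "E = arg_min card U"
  have E: "U E" and E_min: "\<And>F. U F \<Longrightarrow> card E \<le> card F"
    using arg_min_nat_lemma[of U D card] D unfolding E_def U_def by auto
  have "connected_on E p"
    unfolding connected_on_def
  proof (intro allI impI, rule ccontr)
    fix T assume T: "T \<subseteq> E" "T \<noteq> {}" "T \<noteq> E"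
      and neg: "\<not> (\<exists>c. \<exists>t\<in>T. \<exists>w\<in>E - T. row p c w < row p c t)"
    have lt: "row p c t < row p c w" if "t \<in> T" "w \<in> E - T" for c t w
      using neg that row_eq_iff[OF p, of c t w] by (metis DiffD2 linorder_neqE_nat)
    have "row p c z < row p c w" if "z \<in> D - (E - T)" "w \<in> E - T" for z w c
      using that lt[of z w c] E unfolding U_def by (cases "z \<in> E") auto
    then have "U (E - T)" using E T unfolding U_def by auto
    moreover have "card (E - T) < card E" using T by (intro psubset_card_mono) auto
    ultimately show False using E_min by force
  qed
  then show thesis using that E unfolding U_def by blast
qed

text \<open>Blocks are peeled off from the right: a closed sweep on the last irreducible block
  \<open>E\<close>, then \<open>card E\<close> rotations, after which the remaining letters
  \<open>F\<close> end the top row. The blocks are orthogonal because \<open>F\<close> precedes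
  \<open>E\<close> in both rows.\<close>

lemma rotating_sweep:
  fixes p :: "('a::finite) perm_pair"
  assumes "is_perm p" "top_final D p" "winner p False \<notin> D"
  shows "rotating_sweep D p"
  using assms
proof (induction "card D" arbitrary: D p rule: less_induct)
  case less
  note p = less.prems(1) and Df = less.prems(2)
  define A where "A = winner p False"
  have AD: "A \<notin> D" using less.prems(3) by (simp add: A_def)
  show ?case
  proof (cases "D = {}")
    case True
    then show ?thesis
      using sweep_refl[of "insert A D" p] lagr_empty[of p] unfolding rotating_sweep_def A_def
      by (intro exI[of _ "{}"] exI[of _ "mat 1"]) simp
  next
    case False
    obtain E where E: "E \<subseteq> D" "E \<noteq> {}" "connected_on E p"
      "\<And>z w c. z \<in> D - E \<Longrightarrow> w \<in> E \<Longrightarrow> row p c z < row p c w"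
      using top_block[OF p False] by blast
    define F where "F = D - E"
    let ?k = "card E"
    have "card F + ?k = card D"
      using E(1) by (simp add: F_def card_Diff_subset card_mono)
    moreover have "0 < ?k" using E(2) by (simp add: card_gt_0_iff)
    ultimately have cF: "card F + ?k = card D" "card F < card D" by auto
    have Ef: "top_final E p"
      using Df E(1,4) unfolding top_final_def by blast
    have "closed_sweep E p"
    proof (rule closed_sweep_step[OF p Ef E(3,2)])
      fix G and q :: "'a perm_pair"
      assume "card G < card E" "is_perm q" "top_final G q" "winner q False \<notin> G"
      then show "rotating_sweep G q"
        using less.hyps[of G q] cF by simp
    qed
    then obtain Q2 K2 where s2: "sweep E p Q2 p K2" and l2: "lagr E p Q2"
      unfolding closed_sweep_def by blast
    have aD: "row p True A + card D \<le> CARD('a)"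
      using top_final_iff[OF p Df, of A] AD by simp
    have le: "row p (\<not> False) (winner p False) + ?k \<le> CARD('a)"
      using aD cF by (simp add: A_def)
    define p2 where "p2 = cyc p False ?k"
    note c = cyc[OF p le, folded p2_def, simplified, folded A_def]
    have notE: "row p True z + ?k \<le> CARD('a)" if "z \<notin> E" for z
      using top_final_iff[OF p Ef, of z] that by simp
    obtain Kr where sr: "sweep (insert A D) p {} p2 Kr"
      and fr: "\<And>z. z \<notin> E \<Longrightarrow> axis z 1 v* Kr = axis z (1::real)"
      using sweep_cyc[OF p _ le, of "insert A D"] notE unfolding p2_def by (auto simp: A_def)
    have aw: "row p True A < row p True w" if "w \<in> D" for w
      using Df AD that unfolding top_final_def by blast
    have Ff: "top_final F p2"
      unfolding top_final_def
    proof (intro allI impI)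
      fix z w assume z: "z \<notin> F" and w: "w \<in> F"
      have wD: "w \<in> D" "w \<notin> E" using w by (auto simp: F_def)
      show "row p2 True z < row p2 True w"
      proof (cases "z \<in> E")
        case True
        then have "CARD('a) < row p True z + ?k" using top_final_iff[OF p Ef] by blast
        then show ?thesis
          unfolding c(4) using aw[OF wD(1)] notE[OF wD(2)] row_bounds(2)[OF p, of True z] aD cF
          by (auto simp: rot_def)
      next
        case False
        then have "row p True z < row p True w"
          using z wD Df unfolding top_final_def F_def by blast
        then show ?thesis unfolding c(4) using notE[OF wD(2)] by (rule rot_less_low)
      qed
    qed
    have "rotating_sweep F p2"
      using less.hyps[OF cF(2) c(1) Ff] AD c(3) by (auto simp: F_def)
    then obtain Q1 K1 where s1: "sweep (insert A F) p2 Q1 (cyc p2 False (card F)) K1"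
      and l1: "lagr F p2 Q1" and f1: "\<And>z. low z F p2 \<Longrightarrow> axis z 1 v* K1 = axis z (1::real)"
      unfolding rotating_sweep_def c(3) by blast
    have f2: "axis z 1 v* K2 = axis z (1::real)" if "low z E p" for z
      using sweep_low[OF s2 p that] by blast
    have s2': "sweep (insert A D) p Q2 p K2"
      using sweep_mono[OF s2, of "insert A D"] E(1) by blast
    have s1': "sweep (insert A D) p2 Q1 (cyc p2 False (card F)) K1"
      using sweep_mono[OF s1, of "insert A D"] unfolding F_def by blast
    have s: "sweep (insert A D) p Q2 p2 (Kr ** K2)" using sweep_trans[OF s2' sr] by simp
    \<comment> \<open>Letters of \<open>F\<close> are low for \<open>E\<close>, and in the rotations
      by \<open>card E\<close> only letters of \<open>E\<close> lose. Hence the family for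
      \<open>F\<close> will pull back to \<open>p\<close> unchanged.\<close>
    have fF: "axis z 1 v* (Kr ** K2) = axis z (1::real)" if "z \<notin> E" "low z E p" for z
      using fr[OF that(1)] f2[OF that(2)] by (simp add: vector_matrix_mul_assoc[symmetric])
    have "axis z 1 v* (Kr ** K2) = axis z (1::real)" if "z \<in> F" for z
      using fF that E(4) unfolding F_def low_def by blast
    note r = lagr_restrict[OF s p l1 this]
    have s12: "sweep (insert A D) p (Q2 \<union> Q1) (cyc p2 False (card F)) (K1 ** (Kr ** K2))"
      using sweep_trans[OF s s1'] r(2) by simp
    have fin: "cyc p2 False (card F) = cyc p False (card D)"
      unfolding p2_def cF(1)[symmetric] by (simp add: funpow_add)
    have "Omega p $ z $ w = 0" if "z \<in> E" "w \<in> F" for z w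
      using E(4)[of w z True] E(4)[of w z False] that unfolding F_def by (auto simp: Omega_nth)
    then have l: "lagr D p (Q2 \<union> Q1)"
      using lagr_union[OF l2 r(1)] E(1) by (simp add: F_def Un_absorb1)
    have "axis z 1 v* (K1 ** (Kr ** K2)) = axis z (1::real)" if z: "low z D p" for z
    proof -
      have zE: "low z E p" using z E(1) unfolding low_def by blast
      have zn: "z \<notin> E" using zE unfolding low_def by blast
      have "row p2 c z < row p2 c w" if "w \<in> F" for w c
      proof (cases c)
        case True
        have wD: "w \<in> D" "w \<notin> E" using that by (auto simp: F_def)
        have "row p True z < row p True w" using z wD unfolding low_def by blast
        then have "row p2 True z < row p2 True w"
          unfolding c(4) using notE[OF wD(2)] by (rule rot_less_low)
        then show ?thesis using True by simp
      next
        case False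
        then show ?thesis using z that unfolding low_def F_def by (auto simp: c(2))
      qed
      then have "low z F p2" unfolding low_def by blast
      then show ?thesis
        using f1 fF[OF zn zE] by (simp add: vector_matrix_mul_assoc[symmetric])
    qed
    then show ?thesis
      using s12 l unfolding fin rotating_sweep_def A_def[symmetric] by blast
  qed
qed

lemma closed_sweep:
  fixes p :: "('a::finite) perm_pair"
  assumes "is_perm p" "top_final B p" "connected_on B p" "B \<noteq> {}"
  shows "closed_sweep B p"
  using closed_sweep_step[OF assms rotating_sweep] by blast

subsection \<open>From sweeps to elements of the Rauzy monoid\<close>

lemma path_end_append: "path_end p (bs @ cs) = path_end (path_end p bs) cs"
  by (simp add: path_end_def)

lemma theta_append: "theta p (bs @ cs) = theta (path_end p bs) cs ** theta p bs"
  by (induction bs arbitrary: p) (simp_all add: path_end_def matrix_mul_assoc)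

lemma path_end_replicate: "path_end p (replicate k b) = cyc p b k"
  by (induction k arbitrary: p) (simp_all add: path_end_def funpow_Suc_right del: funpow.simps(2))

text \<open>The losers are the last \<open>k\<close> letters of the other row, each once, and the
  winner's coordinate never changes.\<close>

lemma theta_replicate:
  fixes p :: "('a::finite) perm_pair"
  assumes "is_perm p" "row p (\<not> b) (winner p b) + k \<le> CARD('a)"
  shows "theta p (replicate k b) *v v =
    v + v $ winner p b *\<^sub>R (\<Sum>z | CARD('a) < row p (\<not> b) z + k. axis z 1)"
  using assms
proof (induction k arbitrary: p v)
  case 0
  then have "{z. CARD('a) < row p (\<not> b) z + 0} = {}"
    using row_bounds(2)[of p "\<not> b"] by (auto simp: not_less)
  then show ?case by simp
next
  case (Suc k)
  let ?w = "winner p b" and ?l = "loser p b" and ?p = "rauzy_step p b"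
  let ?a = "row p (\<not> b) ?w"
  note p = Suc.prems(1)
  have wl: "?w \<noteq> ?l" using winner_row_less[OF p] Suc.prems(2) by simp
  note p' = is_perm_step[OF p wl] and w' = winner_step[OF p wl] and r' = row_step_other[OF p wl]
  have le: "row ?p (\<not> b) (winner ?p b) + k \<le> CARD('a)"
    unfolding w' r' using Suc.prems(2) by (simp add: rot_def)
  have l: "row p (\<not> b) ?l = CARD('a)" using row_loser[OF p] .
  let ?S = "{z. CARD('a) < row ?p (\<not> b) z + k}"
  have lS: "?l \<notin> ?S" unfolding mem_Collect_eq r' l using Suc.prems(2) by (simp add: rot_def)
  have "CARD('a) < row ?p (\<not> b) z + k \<longleftrightarrow> CARD('a) < row p (\<not> b) z + Suc k" if "z \<noteq> ?l" for z
    using that row_less_card[OF p, of z "\<not> b"] Suc.prems(2)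
    unfolding r' by (auto simp: rot_def loser_eq_winner)
  then have "CARD('a) < row p (\<not> b) z + Suc k \<longleftrightarrow> z = ?l \<or> z \<in> ?S" for z
    using l by (cases "z = ?l") auto
  then have S: "{z. CARD('a) < row p (\<not> b) z + Suc k} = insert ?l ?S" by blast
  have ax: "axis ?l c = c *\<^sub>R axis ?l (1::real)" for c by (simp add: axis_def vec_eq_iff)
  have "theta p (replicate (Suc k) b) *v v = theta ?p (replicate k b) *v (theta_arrow p b *v v)"
    by (simp add: matrix_vector_mul_assoc)
  also have "\<dots> = v + axis ?l (v $ ?w) + v $ ?w *\<^sub>R (\<Sum>z\<in>?S. axis z 1)"
    unfolding Suc.IH[OF p' le] theta_arrow_mult[OF wl] w' using wl by (simp add: axis_def)
  also have "\<dots> = v + v $ ?w *\<^sub>R (\<Sum>z\<in>insert ?l ?S. axis z 1)"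
    using lS ax[of "v $ ?w"] by (simp add: scaleR_add_right)
  finally show ?case unfolding S .
qed

text \<open>The column of the last top letter has no negative entries; it is the indicator of the
  letters that lose in one full top cycle.\<close>

lemma Omega_winner_top:
  fixes p :: "('a::finite) perm_pair"
  assumes "is_perm p"
  shows "(\<Sum>z | row p False (winner p True) < row p False z. axis z 1) = Omega p *v axis (winner p True) 1"
proof (rule vec_eq_iff[THEN iffD2], rule allI)
  fix i
  let ?w = "winner p True"
  have "row p True i < row p True ?w" if "i \<noteq> ?w" using row_less_winner[OF assms that] .
  then have "(Omega p *v axis ?w 1) $ i = (if row p False ?w < row p False i then 1 else 0)"
    by (cases "i = ?w") (auto simp: matrix_vector_mult_basis column_def Omega_nth)
  then show "(\<Sum>z | row p False ?w < row p False z. axis z 1) $ i = (Omega p *v axis ?w 1) $ i"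
    by (simp add: axis_def if_distrib cong: if_cong)
qed

text \<open>Powers of the full cycle are linear in \<open>n\<close> because the vector it adds has
  zero coordinate at the winner.\<close>

lemma transvection_loop:
  fixes p :: "('a::finite) perm_pair"
  assumes "is_perm p"
  obtains bs where "path_end p bs = p"
    "\<And>v. theta p bs *v v = v + (real n * v $ winner p True) *\<^sub>R (Omega p *v axis (winner p True) 1)"
proof -
  let ?w = "winner p True"
  let ?e = "Omega p *v axis ?w 1"
  let ?k = "CARD('a) - row p False ?w"
  have k: "row p (\<not> True) ?w + ?k \<le> CARD('a)" using row_bounds(2)[OF assms, of False ?w] by simp
  have pe: "path_end p (replicate ?k True) = p"
    using path_end_replicate[of p ?k True] cyc_period[OF assms, of True] by simp
  have "(CARD('a) < row p (\<not> True) z + ?k) = (row p False ?w < row p False z)" for z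
    using row_bounds(2)[OF assms, of False ?w] by auto
  then have th: "theta p (replicate ?k True) *v v = v + v $ ?w *\<^sub>R ?e" for v
    using theta_replicate[OF assms k, of v] Omega_winner_top[OF assms] by simp
  have e: "?e $ ?w = 0" by (simp add: matrix_vector_mult_basis column_def Omega_nth)
  have "path_end p (concat (replicate n (replicate ?k True))) = p \<and>
    (\<forall>v. theta p (concat (replicate n (replicate ?k True))) *v v = v + (real n * v $ ?w) *\<^sub>R ?e)"
  proof (induction n)
    case 0
    then show ?case by (simp add: path_end_def)
  next
    case (Suc n)
    then show ?case
      by (simp add: path_end_append theta_append pe matrix_vector_mul_assoc[symmetric] th e
          algebra_simps)
  qed
  then show thesis using that by blast
qed

lemma matrix_vector_mult_sum:
  fixes K :: "real^'n^'m"
  shows "K *v (\<Sum>i\<in>I. f i) = (\<Sum>i\<in>I. K *v f i)"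
  using linear_sum[OF matrix_vector_mul_linear[of K]] by simp

text \<open>Inserting loops with arbitrary multiplicities along a sweep. As the transvection vectors are pairwise
  orthogonal with respect to \<open>Omega p\<close>, all the mixed terms in the product vanish.\<close>
lemma sweep_theta:
  fixes p :: "('a::finite) perm_pair" and n :: "real^'a \<Rightarrow> nat"
  assumes "sweep B p Q p' K" "is_perm p"
    and "\<And>q q'. q \<in> Q \<Longrightarrow> q' \<in> Q \<Longrightarrow> q \<bullet> (Omega p *v q') = 0"
  shows "\<exists>bs. path_end p bs = p' \<and>
    (\<forall>v. theta p bs *v v = K *v (v + (\<Sum>q\<in>Q. (real (n q) * (q \<bullet> v)) *\<^sub>R (Omega p *v q))))"
  using assms
proof (induction arbitrary: n rule: sweep.induct)
  case (sweep_refl p)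
  show ?case by (rule exI[of _ "[]"]) (simp add: path_end_def)
next
  case (sweep_step p b)
  show ?case by (rule exI[of _ "[b]"]) (simp add: path_end_def)
next
  case (sweep_loop p)
  obtain bs where "path_end p bs = p"
    "\<And>v. theta p bs *v v = v + (real (n (axis (winner p True) 1)) * v $ winner p True) *\<^sub>R
      (Omega p *v axis (winner p True) 1)"
    using transvection_loop[OF sweep_loop(2), where n = "n (axis (winner p True) 1)"] by blast
  then show ?case by (intro exI[of _ bs]) (simp add: inner_axis')
next
  case (sweep_trans p Q p' K Q' p'' K')
  note p = sweep_trans.prems(1) and iso = sweep_trans.prems(2) and s = sweep_trans.hyps
  define \<phi> where "\<phi> q = q v* K" for q
  have form: "q \<bullet> (Omega p' *v q') = \<phi> q \<bullet> (Omega p *v \<phi> q')" for q q'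
    using sweep_form[OF s(1) p] by (simp add: \<phi>_def)
  have Om: "Omega p' *v q = K *v (Omega p *v \<phi> q)" for q
    using sweep_Omega[OF s(1) p] by (simp add: \<phi>_def)
  have iso': "\<And>q q'. q \<in> Q \<union> \<phi> ` Q' \<Longrightarrow> q' \<in> Q \<union> \<phi> ` Q' \<Longrightarrow> q \<bullet> (Omega p *v q') = 0"
    using iso unfolding \<phi>_def .
  \<comment> \<open>A vector occurring in both halves is counted once in the union, so its
    multiplicity is given to the first half and \<open>0\<close> to the second.\<close>
  define m where "m q = (if q \<in> Q then 0 else n q)" for q
  have "\<exists>bs. path_end p bs = p' \<and>
    (\<forall>v. theta p bs *v v = K *v (v + (\<Sum>q\<in>Q. (real (n q) * (q \<bullet> v)) *\<^sub>R (Omega p *v q))))"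
    using sweep_trans.IH(1)[OF p] iso' by simp
  then obtain bs where bs: "path_end p bs = p'"
    "\<And>v. theta p bs *v v = K *v (v + (\<Sum>q\<in>Q. (real (n q) * (q \<bullet> v)) *\<^sub>R (Omega p *v q)))"
    by blast
  have "\<exists>cs. path_end p' cs = p'' \<and> (\<forall>v. theta p' cs *v v =
      K' *v (v + (\<Sum>q\<in>Q'. (real (m (\<phi> q)) * (q \<bullet> v)) *\<^sub>R (Omega p' *v q))))"
    using sweep_trans.IH(2)[OF sweep_is_perm[OF s(1) p], of "\<lambda>q. m (\<phi> q)"] form iso' by simp
  then obtain cs where cs: "path_end p' cs = p''" "\<And>v. theta p' cs *v v =
      K' *v (v + (\<Sum>q\<in>Q'. (real (m (\<phi> q)) * (q \<bullet> v)) *\<^sub>R (Omega p' *v q)))"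
    by blast
  have fin: "finite Q" "finite Q'" using s sweep_finite by blast+
  obtain J where "K ** J = mat 1" using sweep_inverse[OF s(1)] by blast
  then have "\<phi> q v* J = q" for q by (simp add: \<phi>_def vector_matrix_mul_assoc)
  then have inj: "inj_on \<phi> Q'" by (metis inj_onI)
  have "theta p (bs @ cs) *v v = (K' ** K) *v
      (v + (\<Sum>q\<in>Q \<union> \<phi> ` Q'. (real (n q) * (q \<bullet> v)) *\<^sub>R (Omega p *v q)))" for v
  proof -
    let ?t = "\<lambda>n q. (real (n q) * (q \<bullet> v)) *\<^sub>R (Omega p *v q)"
    define w where "w = theta p bs *v v"
    have w: "w = K *v (v + sum (?t n) Q)" by (simp add: w_def bs(2))
    have qw: "q \<bullet> w = \<phi> q \<bullet> v" if "q \<in> Q'" for q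
    proof -
      \<comment> \<open>By isotropy the loops of the first half do not alter the functionals of the
        second.\<close>
      have "\<phi> q \<bullet> sum (?t n) Q = 0"
        unfolding inner_sum_right using iso' that by (intro sum.neutral) simp
      then show ?thesis
        unfolding w dot_lmul_matrix[symmetric] \<phi>_def[symmetric] by (simp add: inner_add_right)
    qed
    have "(\<Sum>q\<in>Q'. (real (m (\<phi> q)) * (q \<bullet> w)) *\<^sub>R (Omega p' *v q)) = (\<Sum>q\<in>Q'. K *v ?t m (\<phi> q))"
      using qw by (intro sum.cong) (simp_all add: Om matrix_vector_mult_scaleR)
    also have "\<dots> = K *v (\<Sum>q\<in>Q'. ?t m (\<phi> q))"
      by (rule matrix_vector_mult_sum[symmetric])
    also have "(\<Sum>q\<in>Q'. ?t m (\<phi> q)) = sum (?t m) (\<phi> ` Q')"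
      using inj by (simp add: sum.reindex)
    also have "\<dots> = sum (?t n) (\<phi> ` Q' - Q)"
      using fin by (intro sum.mono_neutral_cong_right) (auto simp: m_def)
    finally have "theta p (bs @ cs) *v v =
      K' *v (K *v (v + sum (?t n) Q) + K *v sum (?t n) (\<phi> ` Q' - Q))"
      unfolding theta_append bs(1) matrix_vector_mul_assoc[symmetric] w_def[symmetric] cs(2)
      by (simp only: w)
    also have "\<dots> = (K' ** K) *v (v + (sum (?t n) Q + sum (?t n) (\<phi> ` Q' - Q)))"
      by (simp only: matrix_vector_mul_assoc[symmetric] matrix_vector_right_distrib add.assoc)
    also have "sum (?t n) Q + sum (?t n) (\<phi> ` Q' - Q) = sum (?t n) (Q \<union> (\<phi> ` Q' - Q))"
      using fin by (intro sum.union_disjoint[symmetric]) auto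
    also have "Q \<union> (\<phi> ` Q' - Q) = Q \<union> \<phi> ` Q'" by blast
    finally show ?thesis .
  qed
  moreover have "path_end p (bs @ cs) = p''" using bs cs by (simp add: path_end_append)
  ultimately show ?case unfolding \<phi>_def[symmetric] by blast
qed

section \<open>Irreducibility and the dimension count\<close>

lemma irreducible_connected_on:
  fixes p :: "('a::finite) perm_pair"
  assumes "is_perm p" "irreducible_perm p"
  shows "connected_on UNIV p"
  unfolding connected_on_def
proof (intro allI impI, rule ccontr)
  fix T :: "'a set"
  assume T: "T \<noteq> {}" "T \<noteq> UNIV"
    and neg: "\<not> (\<exists>c. \<exists>t\<in>T. \<exists>w\<in>UNIV - T. row p c w < row p c t)"
  have lt: "row p c t < row p c w" if "t \<notin> - T" "w \<in> - T" for c t w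
    using neg that row_eq_iff[OF assms(1), of c t w] by (metis ComplD Compl_eq_Diff_UNIV ComplI linorder_neqE_nat)
  have cT: "card T < CARD('a)" "0 < card T"
    using T by (auto intro!: psubset_card_mono simp: card_gt_0_iff)
  have "card (- T) = CARD('a) - card T" by (simp add: Compl_eq_Diff_UNIV card_Diff_subset)
  \<comment> \<open>A set preceding its complement in both rows consists of the first
    \<open>card T\<close> letters of each, against irreducibility.\<close>
  then have "z \<in> T \<longleftrightarrow> row p c z \<le> card T" for c z
    using final_iff[OF assms(1), of "- T" c z] lt cT by auto
  then have "row p c -` {1..card T} = T" for c
    using row_bounds(1)[OF assms(1)] by auto
  from this[of True] this[of False] have "fst p -` {1..card T} = snd p -` {1..card T}"
    by (simp add: row_def)
  then show False using assms(2) cT unfolding irreducible_perm_def by auto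
qed

lemma Omega_antisym_form: "u \<bullet> (Omega p *v v) = - ((Omega p *v u) \<bullet> v)"
proof -
  have "u v* Omega p = transpose (Omega p) *v u" by (simp add: transpose_matrix_vector)
  also have "\<dots> = - (Omega p *v u)"
    unfolding transpose_Omega by (simp add: vec_eq_iff matrix_vector_mult_def sum_negf)
  finally show ?thesis by (simp add: dot_lmul_matrix[symmetric])
qed

text \<open>By antisymmetry \<open>Omega p\<close> is injective on its range, and it maps the
  orthogonal complement of \<open>?W\<close> in that range into \<open>?W\<close>. So
  \<open>Q\<close> has at least half of \<open>dim (Hsp p)\<close> independent images.\<close>

lemma lagr_dim:
  fixes p :: "('a::finite) perm_pair"
  assumes l: "lagr UNIV p Q"
  shows "dim (Hsp p) \<le> 2 * dim ((\<lambda>q. Omega p *v q) ` Q)"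
proof -
  let ?O = "\<lambda>v. Omega p *v v"
  let ?W = "span (?O ` Q)" and ?H = "Hsp p"
  have lin: "linear ?O" by (rule matrix_vector_mul_linear)
  have H: "subspace ?H" unfolding Hsp_def using linear_subspace_image[OF lin subspace_UNIV] .
  have WH: "?W \<subseteq> ?H" using H by (intro span_minimal) (auto simp: Hsp_def)
  let ?X = "{y \<in> ?H. \<forall>x\<in>?W. orthogonal x y}"
  have dX: "dim ?X + dim ?W = dim ?H"
    using dim_subspace_orthogonal_to_vectors[OF subspace_span H WH] .
  have X: "subspace ?X"
    using H unfolding subspace_def by (auto simp: orthogonal_clauses)
  have "x = 0" if x: "x \<in> ?X" "?O x = 0" for x
  proof -
    obtain y where "x = ?O y" using x(1) unfolding Hsp_def by auto
    then have "x \<bullet> x = 0" using Omega_antisym_form[of x p y] x(2) by simp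
    then show ?thesis by simp
  qed
  then have "inj_on ?O ?X"
    using linear_injective_on_subspace_0[OF lin X] by blast
  then have "dim (?O ` ?X) = dim ?X" using dim_image_eq[OF lin] X by (simp add: span_eq_iff[THEN iffD2])
  \<comment> \<open>If \<open>x\<close> is in \<open>?X\<close> and \<open>u\<close> is orthogonal
    to \<open>?W\<close>, both are \<open>Omega\<close>-orthogonal to \<open>Q\<close>; coisotropy
    then makes \<open>?O x\<close> orthogonal to \<open>u\<close>.\<close>
  moreover have "?O ` ?X \<subseteq> ?W"
  proof (rule image_subsetI)
    fix x assume x: "x \<in> ?X"
    have U: "q \<bullet> ?O u = 0" if "\<And>y. y \<in> ?W \<Longrightarrow> orthogonal y u" "q \<in> Q" for q u
      using that(1)[of "?O q"] that(2) Omega_antisym_form[of q p u] by (simp add: span_base orthogonal_def)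
    have "?O x \<bullet> u = 0" if u: "\<And>y. y \<in> ?W \<Longrightarrow> orthogonal y u" for u
    proof -
      have "x \<bullet> ?O u = 0"
        by (rule lagr_coisotropic[OF l]) (use U[of x] U[of u] x u in \<open>auto simp: supp_def\<close>)
      then show ?thesis using Omega_antisym_form[of x p u] by simp
    qed
    then have "?O x \<in> ?W\<^sup>\<bottom>\<^sup>\<bottom>"
      unfolding orthogonal_comp_def by (auto simp: orthogonal_def inner_commute)
    then show "?O x \<in> ?W" using orthogonal_comp_self[OF subspace_span] by metis
  qed
  ultimately have "dim ?X \<le> dim ?W" using dim_subset[of "?O ` ?X" ?W] by simp
  then show ?thesis using dX by (simp add: dim_span)
qed

subsection \<open>Singular values of multi-transvections\<close>

text \<open>The Gram operator of \<open>S\<close> has rank at most \<open>card S\<close>, hence a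
  nonzero kernel vector in \<open>V\<close>; its quadratic form is the sum of the squared inner
  products.\<close>

lemma unit_vector_orthogonal:
  fixes V :: "'b::euclidean_space set"
  assumes V: "subspace V" and S: "finite S" "card S < dim V"
  obtains v where "v \<in> V" "norm v = 1" "\<And>q. q \<in> S \<Longrightarrow> q \<bullet> v = 0"
proof -
  define \<phi> where "\<phi> v = (\<Sum>q\<in>S. (q \<bullet> v) *\<^sub>R q)" for v
  have lin: "linear \<phi>"
    by (rule linearI)
      (simp_all add: \<phi>_def inner_add_right scaleR_add_left sum.distrib scaleR_sum_right)
  have "\<exists>v\<in>V. \<phi> v = 0 \<and> v \<noteq> 0"
  proof (rule ccontr)
    assume "\<not> ?thesis"
    then have "inj_on \<phi> (span V)"
      using linear_injective_on_subspace_0[OF lin V] V by (metis span_eq_iff)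
    then have "dim (\<phi> ` V) = dim V" by (rule dim_image_eq[OF lin])
    moreover have "\<phi> ` V \<subseteq> span S"
      unfolding \<phi>_def by (auto intro: span_sum span_scale span_base)
    ultimately show False using dim_le_card[of "\<phi> ` V" S] S by simp
  qed
  then obtain v where v: "v \<in> V" "\<phi> v = 0" "v \<noteq> 0" by blast
  have "(\<Sum>q\<in>S. (q \<bullet> v)\<^sup>2) = v \<bullet> \<phi> v"
    unfolding \<phi>_def inner_sum_right by (simp add: power2_eq_square inner_commute)
  then have "\<And>q. q \<in> S \<Longrightarrow> q \<bullet> v = 0"
    using v(2) S(1) by (simp add: sum_nonneg_eq_0_iff)
  then show thesis
    using that[of "v /\<^sub>R norm v"] v V by (simp add: subspace_scale)
qed

text \<open>\<open>M\<close> bounds the outer supremum and \<open>1 \<le> i\<close> provides unit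
  vectors for the infima, so that \<open>Sup\<close> and \<open>Inf\<close> have their intended
  meaning.\<close>

lemma sval_lower:
  fixes H V :: "(real^'n) set" and f :: "real^'n \<Rightarrow> real^'n"
  assumes i: "1 \<le> i" and V: "subspace V" "V \<subseteq> H" "dim V = i"
    and c: "\<And>v. v \<in> V \<Longrightarrow> norm v = 1 \<Longrightarrow> c \<le> norm (f v)"
    and M: "\<And>v. norm v = 1 \<Longrightarrow> norm (f v) \<le> M"
  shows "c \<le> sval H f i"
proof -
  let ?P = "\<lambda>V. {norm (f v) |v. v \<in> V \<and> norm v = 1}"
  have unit: "\<exists>v\<in>W. norm v = 1" if "subspace W" "dim W = i" for W :: "(real^'n) set"
    using unit_vector_orthogonal[OF that(1), of "{}"] that(2) i by (metis card.empty finite.emptyI less_le_trans zero_less_one)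
  have bdd: "bdd_below (?P W)" for W by (rule bdd_belowI[of _ 0]) auto
  have "Inf (?P W) \<le> M" if W: "subspace W" "dim W = i" for W
  proof -
    obtain v where v: "v \<in> W" "norm v = 1" using unit[OF W] by blast
    then have "Inf (?P W) \<le> norm (f v)" by (intro cInf_lower bdd) blast
    also have "\<dots> \<le> M" using M[OF v(2)] .
    finally show ?thesis .
  qed
  then have "bdd_above {Inf (?P W) |W. subspace W \<and> W \<subseteq> H \<and> dim W = i}"
    by (intro bdd_aboveI[of _ M]) blast
  then have "Inf (?P V) \<le> sval H f i"
    unfolding sval_def using V by (intro cSup_upper) blast+
  moreover have "c \<le> Inf (?P V)"
    using unit[OF V(1,3)] c by (intro cInf_greatest) blast+
  ultimately show ?thesis by simp
qed

text \<open>The subspace \<open>V\<close> makes the supremum one of a nonempty set.\<close>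

lemma sval_upper:
  assumes V: "subspace V" "V \<subseteq> H" "dim V = i"
    and M: "\<And>W. subspace W \<Longrightarrow> dim W = i \<Longrightarrow> \<exists>v\<in>W. norm v = 1 \<and> norm (f v) \<le> M"
  shows "sval H f i \<le> M"
  unfolding sval_def
proof (rule cSup_least)
  show "{Inf {norm (f v) |v. v \<in> V \<and> norm v = 1} |V. subspace V \<and> V \<subseteq> H \<and> dim V = i} \<noteq> {}"
    using V by blast
  fix s assume "s \<in> {Inf {norm (f v) |v. v \<in> V \<and> norm v = 1} |V. subspace V \<and> V \<subseteq> H \<and> dim V = i}"
  then obtain W where W: "subspace W" "dim W = i" and s: "s = Inf {norm (f v) |v. v \<in> W \<and> norm v = 1}"
    by blast
  obtain v where v: "v \<in> W" "norm v = 1" "norm (f v) \<le> M" using M[OF W] by blast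
  have "s \<le> norm (f v)"
    unfolding s by (rule cInf_lower) (use v in \<open>auto intro!: bdd_belowI[of _ 0]\<close>)
  then show "s \<le> M" using v(3) by simp
qed

lemma span_dual:
  fixes e h :: "nat \<Rightarrow> 'b::euclidean_space"
  assumes I: "finite I" and dual: "\<And>j k. j \<in> I \<Longrightarrow> k \<in> I \<Longrightarrow> e j \<bullet> h k = (if j = k then 1 else 0)"
  shows "dim (span (h ` I)) = card I" "v \<in> span (h ` I) \<Longrightarrow> v = (\<Sum>j\<in>I. (e j \<bullet> v) *\<^sub>R h j)"
proof -
  have inj: "inj_on h I" by (rule inj_onI) (metis dual zero_neq_one)
  show expand: "v = (\<Sum>j\<in>I. (e j \<bullet> v) *\<^sub>R h j)" if "v \<in> span (h ` I)" for v
    using that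
  proof (induction rule: span_induct_alt)
    case base
    then show ?case by simp
  next
    case (step c x y)
    then obtain k where k: "k \<in> I" "x = h k" by blast
    have "(\<Sum>j\<in>I. (e j \<bullet> h k) *\<^sub>R h j) = (\<Sum>j\<in>I. if j = k then h k else 0)"
      using dual[OF _ k(1)] by (intro sum.cong) auto
    then have "(\<Sum>j\<in>I. (e j \<bullet> x) *\<^sub>R h j) = x" using k I by simp
    then have "(\<Sum>j\<in>I. (e j \<bullet> (c *\<^sub>R x + y)) *\<^sub>R h j) = c *\<^sub>R x + (\<Sum>j\<in>I. (e j \<bullet> y) *\<^sub>R h j)"
      by (simp add: inner_add_right scaleR_add_left sum.distrib scaleR_scaleR[symmetric]
          scaleR_sum_right[symmetric] del: scaleR_scaleR)
    then show ?case using step(2) by simp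
  qed
  have "independent (h ` I)"
    unfolding independent_explicit_finite_subsets
  proof (intro allI impI ballI)
    fix A u and a :: 'b
    assume A: "A \<subseteq> h ` I" "finite A" and z: "(\<Sum>v\<in>A. u v *\<^sub>R v) = 0" and a: "a \<in> A"
    obtain k where k: "k \<in> I" "a = h k" using a A by blast
    have "u v * (e k \<bullet> v) = (if v = a then u a else 0)" if v: "v \<in> A" for v
    proof -
      obtain j where "j \<in> I" "v = h j" using v A by blast
      then show ?thesis using k dual inj by (auto simp: inj_on_def)
    qed
    then have "e k \<bullet> (\<Sum>v\<in>A. u v *\<^sub>R v) = (\<Sum>v\<in>A. if v = a then u a else 0)"
      by (simp add: inner_sum_right)
    then show "u a = 0" using z a A(2) by simp
  qed
  then show "dim (span (h ` I)) = card I"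
    by (simp add: dim_eq_card_independent card_image[OF inj])
qed

text \<open>The singular values are comparable to those of the diagonal matrix with entries \<open>N j\<close>: for the upper bound
  use a unit vector killed by the first \<open>i - 1\<close> functionals, for the lower bound the span of the first
  \<open>i\<close> dual vectors.\<close>
lemma sval_multi_transvection:
  fixes K J :: "real^'n^'n" and e w h x :: "nat \<Rightarrow> real^'n"
  assumes J: "J ** K = mat 1" and H: "subspace H" and hH: "\<And>j. j \<in> {1..g} \<Longrightarrow> h j \<in> H"
    and eh: "\<And>j k. j \<in> {1..g} \<Longrightarrow> k \<in> {1..g} \<Longrightarrow> e j \<bullet> h k = (if j = k then 1 else 0)"
    and wx: "\<And>j k. j \<in> {1..g} \<Longrightarrow> k \<in> {1..g} \<Longrightarrow> w j \<bullet> x k = (if j = k then 1 else 0)"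
  obtains c U R :: real where "0 < c" "0 < U"
    "\<And>N f i. (\<And>i j. 1 \<le> i \<Longrightarrow> i \<le> j \<Longrightarrow> j \<le> g \<Longrightarrow> N j \<le> N i) \<Longrightarrow> (\<And>i. i \<in> {1..g} \<Longrightarrow> R \<le> N i) \<Longrightarrow>
      (\<And>v. f v = K *v (v + (\<Sum>j=1..g. (N j * (e j \<bullet> v)) *\<^sub>R w j))) \<Longrightarrow> i \<in> {1..g} \<Longrightarrow>
      c * N i \<le> sval H f i \<and> sval H f i \<le> U * N i"
proof -
  obtain a where a: "0 < a" "\<And>v. norm (K *v v) \<le> norm v * a"
    using bounded_linear.pos_bounded[OF matrix_vector_mul_bounded_linear[of K]] by blast
  obtain b where b: "0 < b" "\<And>v. norm (J *v v) \<le> norm v * b"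
    using bounded_linear.pos_bounded[OF matrix_vector_mul_bounded_linear[of J]] by blast
  define E where "E = (\<Sum>j=1..g. norm (e j) * norm (w j))"
  define D where "D = 1 + (\<Sum>j=1..g. norm (h j) * norm (x j))"
  have E: "0 \<le> E" unfolding E_def by (intro sum_nonneg) simp
  have D: "1 \<le> D" unfolding D_def by (simp add: sum_nonneg)
  \<comment> \<open>\<open>a\<close> and \<open>b\<close> bound \<open>K\<close> and its inverse.
    The threshold \<open>2 * D\<close> lets an additive error \<open>D\<close> be absorbed in half
    of \<open>N i\<close>, whence the \<open>2\<close> in \<open>?c\<close>.\<close>
  let ?c = "1 / (2 * D * b)" and ?U = "a * (1 + E)" and ?R = "2 * D"
  show thesis
  proof (rule that[of ?c ?U ?R])
    show "0 < ?c" "0 < ?U" using a(1) b(1) D E by auto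
    fix N :: "nat \<Rightarrow> real" and f i
    assume mono: "\<And>i j. 1 \<le> i \<Longrightarrow> i \<le> j \<Longrightarrow> j \<le> g \<Longrightarrow> N j \<le> N i"
      and R: "\<And>i. i \<in> {1..g} \<Longrightarrow> ?R \<le> N i"
      and f: "\<And>v. f v = K *v (v + (\<Sum>j=1..g. (N j * (e j \<bullet> v)) *\<^sub>R w j))"
      and i: "i \<in> {1..g}"
    define s where "s v = v + (\<Sum>j=1..g. (N j * (e j \<bullet> v)) *\<^sub>R w j)" for v
    have N1: "1 \<le> N j" if "j \<in> {1..g}" for j using R[OF that] D by simp
    define V where "V = span (h ` {1..i})"
    have "V \<subseteq> H"
      unfolding V_def by (rule span_minimal[OF _ H]) (use hH i in auto)
    then have V: "subspace V" "V \<subseteq> H" "dim V = i"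
      unfolding V_def using span_dual(1)[of "{1..i}" e h] eh i by auto
    have bound: "norm (s v) \<le> 1 + (\<Sum>j=1..g. \<bar>N j * (e j \<bullet> v)\<bar> * norm (w j))" if "norm v = 1" for v
      unfolding s_def using that
      by (intro order.trans[OF norm_triangle_ineq] add_mono order.trans[OF norm_sum]) auto
    have upper: "sval H f i \<le> ?U * N i"
    proof (rule sval_upper[OF V])
      fix W :: "(real^'n) set" assume W: "subspace W" "dim W = i"
      have "card (e ` {1..<i}) < dim W"
        using card_image_le[of "{1..<i}" e] i W(2) by auto
      then obtain v where v: "v \<in> W" "norm v = 1" "\<And>q. q \<in> e ` {1..<i} \<Longrightarrow> q \<bullet> v = 0"
        using unit_vector_orthogonal[OF W(1), of "e ` {1..<i}"] by blast
      have "\<bar>N j * (e j \<bullet> v)\<bar> * norm (w j) \<le> N i * (norm (e j) * norm (w j))" if j: "j \<in> {1..g}" for j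
      proof (cases "j < i")
        case True
        then show ?thesis using v(3)[of "e j"] j N1[OF i] by simp
      next
        case False
        have "\<bar>N j\<bar> * \<bar>e j \<bullet> v\<bar> \<le> N i * norm (e j)"
          using mono[of i j] N1[OF j] i j False Cauchy_Schwarz_ineq2[of "e j" v] v(2)
          by (intro mult_mono) auto
        then show ?thesis by (simp add: abs_mult mult_right_mono mult.assoc[symmetric])
      qed
      then have "(\<Sum>j=1..g. \<bar>N j * (e j \<bullet> v)\<bar> * norm (w j)) \<le> N i * E"
        unfolding E_def sum_distrib_left by (rule sum_mono)
      then have "norm (s v) \<le> N i * (1 + E)"
        using bound[OF v(2)] N1[OF i] by (simp add: distrib_left)
      then have "norm (f v) \<le> (N i * (1 + E)) * a"
        unfolding f s_def[symmetric] using a(1)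
        by (intro order.trans[OF a(2)] mult_right_mono) auto
      then have "norm (f v) \<le> ?U * N i" by (simp add: mult_ac)
      then show "\<exists>v\<in>W. norm v = 1 \<and> norm (f v) \<le> ?U * N i" using v by blast
    qed
    have lower: "?c * N i \<le> sval H f i"
    proof (rule sval_lower[OF _ V])
      show "1 \<le> i" using i by simp
      show "norm (f v) \<le> a * (1 + (\<Sum>j=1..g. N j * norm (e j) * norm (w j)))" if v: "norm v = 1" for v
      proof -
        have "\<bar>N j * (e j \<bullet> v)\<bar> * norm (w j) \<le> N j * norm (e j) * norm (w j)" if "j \<in> {1..g}" for j
          using N1[OF that] Cauchy_Schwarz_ineq2[of "e j" v] v
          by (auto simp: abs_mult intro!: mult_right_mono)
        then have "norm (s v) \<le> 1 + (\<Sum>j=1..g. N j * norm (e j) * norm (w j))"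
          using bound[OF v] by (meson add_left_mono order.trans sum_mono)
        then have "norm (f v) \<le> (1 + (\<Sum>j=1..g. N j * norm (e j) * norm (w j))) * a"
          unfolding f s_def[symmetric] using a(1)
          by (intro order.trans[OF a(2)] mult_right_mono) auto
        then show ?thesis by (simp only: mult.commute)
      qed
      fix v assume v: "v \<in> V" "norm v = 1"
      have exp: "v = (\<Sum>j=1..i. (e j \<bullet> v) *\<^sub>R h j)"
        using span_dual(2)[of "{1..i}" e h v] eh i v unfolding V_def by auto
      \<comment> \<open>Pairing \<open>s v\<close> with the dual vector \<open>x k\<close> isolates
        its \<open>k\<close>-th term, up to the bounded quantity
        \<open>v \<bullet> x k\<close>.\<close>
      have "\<bar>e k \<bullet> v\<bar> * N i \<le> norm (x k) * (1 + norm (s v))" if k: "k \<in> {1..i}" for k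
      proof -
        have kg: "k \<in> {1..g}" using k i by auto
        have "(\<Sum>j=1..g. N j * (e j \<bullet> v) * (w j \<bullet> x k)) = (\<Sum>j=1..g. if j = k then N k * (e k \<bullet> v) else 0)"
          using wx kg by (intro sum.cong) auto
        then have "s v \<bullet> x k = v \<bullet> x k + N k * (e k \<bullet> v)"
          using kg unfolding s_def by (simp add: inner_add_left inner_sum_left)
        then have "\<bar>N k * (e k \<bullet> v)\<bar> \<le> \<bar>s v \<bullet> x k\<bar> + \<bar>v \<bullet> x k\<bar>" by linarith
        also have "\<dots> \<le> norm (s v) * norm (x k) + norm v * norm (x k)"
          by (intro add_mono Cauchy_Schwarz_ineq2)
        finally have "N k * \<bar>e k \<bullet> v\<bar> \<le> norm (x k) * (1 + norm (s v))"
          using N1[OF kg] v(2) by (simp add: abs_mult algebra_simps)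
        moreover have "\<bar>e k \<bullet> v\<bar> * N i \<le> N k * \<bar>e k \<bullet> v\<bar>"
          using mono[of k i] k i by (simp add: mult.commute mult_right_mono)
        ultimately show ?thesis by linarith
      qed
      then have "norm (h k) * (\<bar>e k \<bullet> v\<bar> * N i) \<le> norm (h k) * (norm (x k) * (1 + norm (s v)))"
        if "k \<in> {1..i}" for k
        using that by (intro mult_left_mono) auto
      then have "(\<Sum>k=1..i. norm (h k) * (\<bar>e k \<bullet> v\<bar> * N i)) \<le>
          (\<Sum>k=1..i. norm (h k) * norm (x k)) * (1 + norm (s v))"
        unfolding sum_distrib_right by (intro sum_mono) (simp add: mult.assoc)
      moreover have "(\<Sum>k=1..i. norm (h k) * norm (x k)) \<le> (\<Sum>k=1..g. norm (h k) * norm (x k))"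
        using i by (intro sum_mono2) auto
      moreover have "norm v \<le> (\<Sum>k=1..i. norm (h k) * \<bar>e k \<bullet> v\<bar>)"
        by (subst exp, rule order.trans[OF norm_sum]) (simp add: mult.commute)
      then have "N i \<le> (\<Sum>k=1..i. norm (h k) * (\<bar>e k \<bullet> v\<bar> * N i))"
        using v(2) N1[OF i] mult_right_mono[of 1 "\<Sum>k=1..i. norm (h k) * \<bar>e k \<bullet> v\<bar>" "N i"]
        by (simp add: sum_distrib_right mult.assoc)
      ultimately have "N i \<le> D * (1 + norm (s v))"
        unfolding D_def by (smt (verit) mult_right_mono norm_ge_zero)
      then have "N i \<le> 2 * D * norm (s v)" using R[OF i] by (simp add: algebra_simps)
      also have "norm (s v) \<le> norm (f v) * b"
      proof -
        have "J *v f v = s v" unfolding f s_def by (simp add: matrix_vector_mul_assoc J)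
        then show ?thesis using b(2)[of "f v"] by simp
      qed
      finally show "?c * N i \<le> norm (f v)"
        using D b(1) by (simp add: field_simps)
    qed
    show "?c * N i \<le> sval H f i \<and> sval H f i \<le> ?U * N i" using lower upper by blast
  qed
qed

text \<open>The \<open>x c\<close> represent the coordinate functionals of \<open>C\<close>,
  extended linearly to the whole space.\<close>

lemma independent_dual:
  fixes C :: "'b::euclidean_space set"
  assumes "independent C"
  obtains x where "\<And>b c. b \<in> C \<Longrightarrow> c \<in> C \<Longrightarrow> b \<bullet> x c = (if b = c then 1 else (0::real))"
proof -
  have "\<exists>x. \<forall>b\<in>C. b \<bullet> x = (if b = c then 1 else (0::real))" for c
  proof -
    obtain f :: "'b \<Rightarrow> real" where f: "linear f" "\<forall>b\<in>C. f b = (if b = c then 1 else 0)"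
      using linear_independent_extend[OF assms, of "\<lambda>b. if b = c then 1 else 0"] by blast
    then have "\<forall>b\<in>C. b \<bullet> adjoint f 1 = (if b = c then 1 else 0)"
      using adjoint_works[OF f(1), of _ 1] by simp
    then show ?thesis by blast
  qed
  then show thesis using that by metis
qed

subsection \<open>Strong pinching\<close>

text \<open>Needed for \<open>g \<ge> 1\<close>. Some letter follows the last top letter in the
  bottom row, which gives a nonzero entry of \<open>Omega p\<close>.\<close>

lemma Hsp_dim_pos:
  fixes p :: "('a::finite) perm_pair"
  assumes "2 \<le> CARD('a)" "is_perm p" "irreducible_perm p"
  shows "0 < dim (Hsp p)"
proof -
  let ?x = "winner p True"
  have "UNIV - {?x} \<noteq> {}"
  proof
    assume "UNIV - {?x} = {}"
    then have "UNIV = {?x}" by blast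
    then have "CARD('a) = 1" by (metis card_1_singleton_iff One_nat_def)
    then show False using assms(1) by simp
  qed
  then obtain c t w where tw: "t \<in> UNIV - {?x}" "w \<in> UNIV - (UNIV - {?x})" "row p c w < row p c t"
    using irreducible_connected_on[OF assms(2,3)] unfolding connected_on_def by (metis DiffD2 UNIV_I insertI1 subset_UNIV)
  then have t: "t \<noteq> ?x" "row p c ?x < row p c t" by auto
  have "row p True t < row p True ?x" using row_less_winner[OF assms(2) t(1)] .
  then have "c = False" using t(2) by (cases c) auto
  then have "(Omega p *v axis ?x 1) $ t = 1"
    using t(2) \<open>row p True t < row p True ?x\<close>
    by (simp add: matrix_vector_mult_basis column_def Omega_nth)
  then have "Omega p *v axis ?x 1 \<noteq> 0" by (metis zero_index zero_neq_one)
  then have "\<not> Hsp p \<subseteq> {0}" unfolding Hsp_def by blast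
  then show ?thesis by (simp add: dim_eq_0 flip: neq0_conv)
qed

text \<open>The constants are fixed before the multiplicities \<open>N\<close>; this is what allows
  arbitrarily large gaps between the singular values.\<close>

lemma rauzy_monoid_sval:
  fixes p :: "('a::finite) perm_pair"
  assumes p: "is_perm p" "irreducible_perm p" and dim: "dim (Hsp p) = 2 * g"
  obtains c U R :: real where "0 < c" "0 < U"
    "\<And>N :: nat \<Rightarrow> nat. (\<And>i j. 1 \<le> i \<Longrightarrow> i \<le> j \<Longrightarrow> j \<le> g \<Longrightarrow> N j \<le> N i) \<Longrightarrow> (\<And>i. i \<in> {1..g} \<Longrightarrow> R \<le> N i) \<Longrightarrow>
      \<exists>bs\<in>rauzy_monoid p. \<forall>i\<in>{1..g}. c * N i \<le> sval (Hsp p) (\<lambda>v. theta p bs *v v) i \<and>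
        sval (Hsp p) (\<lambda>v. theta p bs *v v) i \<le> U * N i"
proof -
  let ?O = "\<lambda>v. Omega p *v v" and ?I = "{1..g}"
  have "closed_sweep UNIV p"
    using closed_sweep[OF p(1) _ irreducible_connected_on[OF p]] by (simp add: top_final_def)
  then obtain Q K where s: "sweep UNIV p Q p K" and l: "lagr UNIV p Q"
    unfolding closed_sweep_def by blast
  obtain J where J: "J ** K = mat 1" using sweep_inverse[OF s] by blast
  have finQ: "finite Q" using sweep_finite[OF s] .
  obtain B where B: "B \<subseteq> ?O ` Q" "independent B" "?O ` Q \<subseteq> span B" "card B = dim (?O ` Q)"
    by (rule basis_exists)
  have "g \<le> card B" using lagr_dim[OF l] dim B(4) by simp
  then obtain C where C: "C \<subseteq> B" "card C = g" "finite C" using obtain_subset_with_card_n by metis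
  then obtain w where w: "bij_betw w ?I C" using ex_bij_betw_nat_finite_1[OF C(3)] by blast
  have wC: "w j \<in> C" if "j \<in> ?I" for j using bij_betwE[OF w] that by blast
  have wj: "w j = w k \<longleftrightarrow> j = k" if "j \<in> ?I" "k \<in> ?I" for j k
    using w that unfolding bij_betw_def inj_on_def by blast
  have "\<forall>j\<in>?I. \<exists>q\<in>Q. w j = ?O q" using wC C(1) B(1) by blast
  then obtain e where e: "\<And>j. j \<in> ?I \<Longrightarrow> e j \<in> Q" "\<And>j. j \<in> ?I \<Longrightarrow> w j = ?O (e j)" by metis
  have inj: "inj_on e ?I" using e(2) wj by (intro inj_onI) metis
  obtain x where x: "\<And>b c. b \<in> C \<Longrightarrow> c \<in> C \<Longrightarrow> b \<bullet> x c = (if b = c then 1 else (0::real))"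
    using independent_dual[OF independent_mono[OF B(2) C(1)]] by blast
  \<comment> \<open>\<open>Omega p\<close> turns the vectors dual to the \<open>w j\<close> into
    vectors of \<open>Hsp p\<close> dual to the \<open>e j\<close>; the minus sign makes up for
    antisymmetry.\<close>
  define h where "h j = ?O (- x (w j))" for j
  have wx: "w j \<bullet> x (w k) = (if j = k then 1 else 0)" if "j \<in> ?I" "k \<in> ?I" for j k
    using x[OF wC[OF that(1)] wC[OF that(2)]] wj[OF that] by simp
  have eh: "e j \<bullet> h k = (if j = k then 1 else 0)" if "j \<in> ?I" "k \<in> ?I" for j k
    using wx[OF that] e(2)[OF that(1)] Omega_antisym_form[of "e j" p "- x (w k)"]
    by (simp add: h_def)
  have H: "subspace (Hsp p)"
    unfolding Hsp_def using linear_subspace_image[OF matrix_vector_mul_linear subspace_UNIV] .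
  have hH: "h j \<in> Hsp p" for j unfolding h_def Hsp_def by blast
  obtain c U R :: real where cU: "0 < c" "0 < U" and
    bd: "\<And>N f i. (\<And>i j. 1 \<le> i \<Longrightarrow> i \<le> j \<Longrightarrow> j \<le> g \<Longrightarrow> N j \<le> N i) \<Longrightarrow> (\<And>i. i \<in> {1..g} \<Longrightarrow> R \<le> N i) \<Longrightarrow>
      (\<And>v. f v = K *v (v + (\<Sum>j=1..g. (N j * (e j \<bullet> v)) *\<^sub>R w j))) \<Longrightarrow> i \<in> {1..g} \<Longrightarrow>
      c * N i \<le> sval (Hsp p) f i \<and> sval (Hsp p) f i \<le> U * N i"
    by (rule sval_multi_transvection[OF J H hH eh wx]) blast+
  have main: "\<exists>bs\<in>rauzy_monoid p. \<forall>i\<in>{1..g}. c * N i \<le> sval (Hsp p) (\<lambda>v. theta p bs *v v) i \<and>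
        sval (Hsp p) (\<lambda>v. theta p bs *v v) i \<le> U * N i"
    if mono: "\<And>i j. 1 \<le> i \<Longrightarrow> i \<le> j \<Longrightarrow> j \<le> g \<Longrightarrow> N j \<le> N i"
      and R: "\<And>i. i \<in> {1..g} \<Longrightarrow> R \<le> N i" for N :: "nat \<Rightarrow> nat"
  proof -
    \<comment> \<open>Members of \<open>Q\<close> that were not selected get multiplicity
      zero.\<close>
    define n where "n q = (if q \<in> e ` ?I then N (the_inv_into ?I e q) else 0)" for q
    have n: "n (e j) = N j" if "j \<in> ?I" for j
      unfolding n_def using that the_inv_into_f_f[OF inj that] by simp
    obtain bs where bs: "path_end p bs = p"
      "\<And>v. theta p bs *v v = K *v (v + (\<Sum>q\<in>Q. (real (n q) * (q \<bullet> v)) *\<^sub>R ?O q))"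
      using sweep_theta[OF s p(1) lagr_isotropic[OF l], of n] by blast
    have "(\<Sum>q\<in>Q. (real (n q) * (q \<bullet> v)) *\<^sub>R ?O q) = (\<Sum>j=1..g. (real (N j) * (e j \<bullet> v)) *\<^sub>R w j)" for v
    proof -
      have "(\<Sum>q\<in>Q. (real (n q) * (q \<bullet> v)) *\<^sub>R ?O q) = (\<Sum>q\<in>e ` ?I. (real (n q) * (q \<bullet> v)) *\<^sub>R ?O q)"
        using e(1) by (intro sum.mono_neutral_right[OF finQ]) (auto simp: n_def)
      also have "\<dots> = (\<Sum>j=1..g. (real (N j) * (e j \<bullet> v)) *\<^sub>R w j)"
        using inj n e(2) by (simp add: sum.reindex)
      finally show ?thesis .
    qed
    then have th: "theta p bs *v v = K *v (v + (\<Sum>j=1..g. (real (N j) * (e j \<bullet> v)) *\<^sub>R w j))" for v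
      using bs(2) by simp
    have "c * N i \<le> sval (Hsp p) (\<lambda>v. theta p bs *v v) i \<and>
        sval (Hsp p) (\<lambda>v. theta p bs *v v) i \<le> U * N i" if "i \<in> ?I" for i
      by (rule bd[where N = "\<lambda>i. real (N i)"]) (use mono R th that in auto)
    then show ?thesis
      using bs(1) unfolding rauzy_monoid_def by blast
  qed
  show thesis by (rule that[of c U R, OF cU], rule main) simp_all
qed

theorem theorem6p1:
  fixes p :: "('a::finite \<Rightarrow> nat) \<times> ('a \<Rightarrow> nat)" and g :: nat
  assumes "CARD('a) \<ge> 2" and "is_perm p" and "irreducible_perm p"
    and "dim (Hsp p) = 2 * g"
  shows "\<forall>C::real. C > 0 \<longrightarrow> (\<exists>bs \<in> rauzy_monoid p.
           ln (sval (Hsp p) (\<lambda>v. theta p bs *v v) g) > C \<and>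
           (\<forall>i. 1 \<le> i \<and> i \<le> g - 1 \<longrightarrow>
              ln (sval (Hsp p) (\<lambda>v. theta p bs *v v) i)
                > C * ln (sval (Hsp p) (\<lambda>v. theta p bs *v v) (i + 1))))"
proof (intro allI impI)
  fix C :: real
  assume C: "C > 0"
  have g: "1 \<le> g" using Hsp_dim_pos[OF assms(1-3)] assms(4) by simp
  obtain c U R :: real where cU: "0 < c" "0 < U" and
    bd: "\<And>N :: nat \<Rightarrow> nat. (\<And>i j. 1 \<le> i \<Longrightarrow> i \<le> j \<Longrightarrow> j \<le> g \<Longrightarrow> N j \<le> N i) \<Longrightarrow> (\<And>i. i \<in> {1..g} \<Longrightarrow> R \<le> N i) \<Longrightarrow>
      \<exists>bs\<in>rauzy_monoid p. \<forall>i\<in>{1..g}. c * N i \<le> sval (Hsp p) (\<lambda>v. theta p bs *v v) i \<and>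
        sval (Hsp p) (\<lambda>v. theta p bs *v v) i \<le> U * N i"
    using rauzy_monoid_sval[OF assms(2-4)] by blast
  \<comment> \<open>With \<open>k \<ge> C + 1\<close>, beyond the factor \<open>C\<close> one copy
    of \<open>ln (N (i + 1))\<close> remains to absorb the constants.\<close>
  define k where "k = nat \<lceil>C\<rceil> + 1"
  have k: "C + 1 \<le> real k" "1 \<le> k" unfolding k_def using C by linarith+
  \<comment> \<open>The first two terms cover the losses from \<open>U\<close> and \<open>c\<close>,
    the summand \<open>C\<close> is for the last singular value, and \<open>1\<close> gives
    strictness.\<close>
  define Y where "Y = C * \<bar>ln U\<bar> + \<bar>ln c\<bar> + C + 1"
  obtain m :: nat where "max R (exp Y) \<le> m" using real_arch_simple by blast
  then have m: "R \<le> m" "exp Y \<le> m" by auto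
  have Y: "1 \<le> Y" unfolding Y_def using C by simp
  then have "1 \<le> exp Y" by simp
  then have m1: "1 \<le> m" using m(2) by linarith
  have L: "Y \<le> ln m" using m(2) m1 by (simp add: ln_ge_iff)
  \<comment> \<open>For \<open>i < g\<close>, \<open>N i\<close> is the \<open>k\<close>-th power of
    \<open>N (i + 1)\<close>, starting from \<open>N g = m\<close>.\<close>
  define N where "N i = m ^ (k ^ (g - i))" for i
  have lnN: "ln (N i) = real (k ^ (g - i)) * ln m" for i
    unfolding N_def using m1 by (simp add: ln_realpow)
  have mono: "N j \<le> N i" if "i \<le> j" for i j
    unfolding N_def using m1 k(2) that by (intro power_increasing) auto
  have R: "R \<le> N i" for i
  proof -
    have "m ^ 1 \<le> N i" unfolding N_def using m1 k(2) by (intro power_increasing) auto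
    then show ?thesis using m(1) by simp
  qed
  have "\<exists>bs\<in>rauzy_monoid p. \<forall>i\<in>{1..g}. c * N i \<le> sval (Hsp p) (\<lambda>v. theta p bs *v v) i \<and>
        sval (Hsp p) (\<lambda>v. theta p bs *v v) i \<le> U * N i"
    by (rule bd) (simp_all add: mono R)
  then obtain bs where bs: "bs \<in> rauzy_monoid p"
    and sv: "\<And>i. i \<in> {1..g} \<Longrightarrow> c * N i \<le> sval (Hsp p) (\<lambda>v. theta p bs *v v) i \<and>
        sval (Hsp p) (\<lambda>v. theta p bs *v v) i \<le> U * N i"
    by blast
  let ?s = "sval (Hsp p) (\<lambda>v. theta p bs *v v)"
  have Npos: "0 < real (N i)" for i unfolding N_def using m1 by simp
  have lower: "ln c + ln (N i) \<le> ln (?s i)" if "i \<in> {1..g}" for i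
  proof -
    have "ln (c * N i) \<le> ln (?s i)"
      using sv[OF that] mult_pos_pos[OF cU(1) Npos[of i]] by (intro ln_mono) auto
    then show ?thesis using cU(1) Npos[of i] by (simp add: ln_mult)
  qed
  have upper: "ln (?s i) \<le> ln U + ln (N i)" if "i \<in> {1..g}" for i
  proof -
    have "ln (?s i) \<le> ln (U * N i)"
      using sv[OF that] mult_pos_pos[OF cU(1) Npos[of i]] by (intro ln_mono) auto
    then show ?thesis using cU(2) Npos[of i] by (simp add: ln_mult)
  qed
  show "\<exists>bs\<in>rauzy_monoid p. ln (sval (Hsp p) (\<lambda>v. theta p bs *v v) g) > C \<and>
      (\<forall>i. 1 \<le> i \<and> i \<le> g - 1 \<longrightarrow> ln (sval (Hsp p) (\<lambda>v. theta p bs *v v) i)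
        > C * ln (sval (Hsp p) (\<lambda>v. theta p bs *v v) (i + 1)))"
  proof (intro bexI[OF _ bs] conjI allI impI)
    have "0 \<le> C * \<bar>ln U\<bar>" using C by simp
    moreover have "ln (N g) = ln m" using lnN[of g] by simp
    moreover have "g \<in> {1..g}" using g by simp
    ultimately show "C < ln (?s g)" using lower[of g] L unfolding Y_def by linarith
    fix i assume i: "1 \<le> i \<and> i \<le> g - 1"
    have iI: "i \<in> {1..g}" "i + 1 \<in> {1..g}" using i by auto
    define a where "a = real (k ^ (g - (i + 1))) * ln m"
    have "g - i = Suc (g - (i + 1))" using i by linarith
    then have Ni: "ln (N i) = k * a" "ln (N (i + 1)) = a" unfolding lnN a_def by simp_all
    have "1 * ln m \<le> a"
      unfolding a_def using k(2) L Y by (intro mult_right_mono) (simp_all add: one_le_power)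
    then have aY: "Y \<le> a" "0 \<le> a" using L Y by auto
    have "(C + 1) * a \<le> k * a" using k(1) aY(2) by (rule mult_right_mono)
    then have "ln c + C * a + a \<le> ln (?s i)" using lower[OF iI(1)] Ni by (simp add: algebra_simps)
    moreover have "C * ln (?s (i + 1)) \<le> C * (ln U + a)"
      using upper[OF iI(2)] Ni(2) C by (intro mult_left_mono) auto
    moreover have "C * ln U \<le> C * \<bar>ln U\<bar>" using C by (intro mult_left_mono) auto
    ultimately show "C * ln (?s (i + 1)) < ln (?s i)"
      using aY(1) C unfolding Y_def distrib_left by linarith
  qed
qed

end
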